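(* Let $p>2$, let $k_i\ge 0$ ($i\in\mathbb{Z}/f\mathbb{Z}$) be integers and let $(\mathcal A^{(i)})_{i\in\mathbb{Z}/f\mathbb{Z}}$ with $\mathcal A^{(i)}\in\mathrm{Mat}_2^{k_i}(S_F)$ and $\det\mathcal A^{(i)}\in E^{k_i}\mathscr O_F^*$ be the partial Frobenius matrices of a rank-two Kisin module over $S_F$ with labeled heights $k_i$. Suppose there exist an integer $c>1$ and a sequence of $f$-tuples $(X_n)_{n\ge1}$, $X_n=(X_n^{(i)})_i$, such that, setting $\mathcal A_0=\mathcal A$ and $\mathcal A_n=(X_n)*_\varphi(\mathcal A_{n-1})$: (1) $c(p-2)\ge k_i$ for all $i$; (2) each $X_n^{(i)}$ is either an element of $\mathrm{GL}_2(S_F[1/p])$ with $\det X_n^{(i)}=1$ or a diagonal matrix $\mathrm{Diag}(x,y)\in\mathrm{GL}_2(F)$; (3) there is a finite $m>0$ with $\mathcal A_m^{(i)}=\mathfrak A_0^{(i)}+C^{(i)}$, where $\mathfrak A_0^{(i)}\in\mathrm{Mat}_2(\mathfrak S_F)$ and $C^{(i)}\in\mathrm{Mat}_2(I_c)$, for all $i$. Then there exists $(Y^{(i)})\in\mathrm{GL}_2(R[1/p])^f$ such that $(Y^{(i)})*_\varphi(\mathcal A^{(i)})=(\mathfrak A^{(i)})$ with $\mathfrak A^{(i)}\in\mathrm{Mat}_2^{k_i}(\mathfrak S_F)$ and $\mathfrak A^{(i)}\equiv\mathfrak A_0^{(i)}\pmod{\varpi}$ for all $i$.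
   Context: $F/\mathbb{Q}_p$ finite with ring of integers $\mathscr O_F$ and uniformizer $\varpi$; $f\ge1$. Put $\mathfrak S_F=\mathscr O_F[[u]]$, $E=u+p$, and let $\varphi$ be the $\mathscr O_F$-linear endomorphism of $F[[u]]$ with $\varphi(u)=u^p$ (applied entrywise to matrices). $S_F=\mathfrak S_F[[E^p/p]]$ is the subring of $F[[u]]$ of elements $\sum_{j\ge0}a_j(E^p/p)^j$ with $a_j\in\mathfrak S_F$, with $\mathrm{Fil}^jS_F=E^jS_F$; $R=\mathfrak S_F[[\varpi E/p]]$ is defined analogously. For an integer $c>1$, $I_c=\varpi p^{c-1}S_F+\varpi\,\mathrm{Fil}^{cp}S_F+E\,\mathrm{Fil}^{cp}S_F$. For a ring $\mathfrak S_F\subset\mathcal S\subset F[[u]]$ and $h\ge0$, $\mathrm{Mat}_d^h(\mathcal S)$ is the set of $A\in\mathrm{Mat}_d(\mathcal S)$ for which some $B\in\mathrm{Mat}_d(\mathcal S)$ satisfies $AB=BA=E^h\mathbb I_d$. For $f$-tuples indexed by $\mathbb{Z}/f\mathbb{Z}$, $(X^{(i)})*_\varphi(\mathcal A^{(i)})$ denotes the $f$-tuple $(X^{(i)}\mathcal A^{(i)}\varphi(X^{(i-1)})^{-1})_i$.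
   Formalization: The formal theorem adds the hypothesis S_F ⊂ R, which for p>2 means F/Q_p is ramified; for unramified F one has R = 𝔖_F and the claim fails, e.g. f=1, k=0, A = X^{-1}φ(X) with X unipotent with entry Σ(E^p/p)^j. *)

theory Defs
  imports "HOL-Analysis.Analysis" "HOL-Computational_Algebra.Computational_Algebra"
begin

definition padic_abs :: "nat \<Rightarrow> rat \<Rightarrow> real" where
  "padic_abs p x = (if x = 0 then 0 else
     real p powi (int (multiplicity (int p) (snd (quotient_of x)))
                - int (multiplicity (int p) (fst (quotient_of x)))))"

text \<open>
  The field of p-adic numbers inside a valued field extending the p-adically valued rationals:
  the closure of the rationals. It is a completion of the rationals as soon as
  rational Cauchy sequences have limits.
\<close>

definition Qp_in :: "('a::field_char_0 \<Rightarrow> real) \<Rightarrow> 'a set" where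
  "Qp_in nrm = {x. \<exists>q :: nat \<Rightarrow> rat. (\<lambda>n. nrm (x - of_rat (q n))) \<longlonglongrightarrow> 0}"

text \<open>
  A finite extension \<open>F\<close> of the p-adic numbers, realised on the type \<open>'a\<close>. The function \<open>nrm\<close> is the
  (unique) extension of the p-adic absolute value to \<open>F\<close>.
\<close>

locale finite_ext_Qp =
  fixes p :: nat and nrm :: "'a::field_char_0 \<Rightarrow> real"
  assumes prime_p: "prime p"
    and nrm_nonneg: "\<And>x. 0 \<le> nrm x"
    and nrm_eq_0_iff: "\<And>x. nrm x = 0 \<longleftrightarrow> x = 0"
    and nrm_mult: "\<And>x y. nrm (x * y) = nrm x * nrm y"
    and nrm_add_le_max: "\<And>x y. nrm (x + y) \<le> max (nrm x) (nrm y)"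
    and nrm_of_rat: "\<And>q. nrm (of_rat q) = padic_abs p q"
    and Qp_complete: "\<And>q :: nat \<Rightarrow> rat.
          (\<forall>e>0. \<exists>N. \<forall>m\<ge>N. \<forall>n\<ge>N. padic_abs p (q m - q n) < e) \<Longrightarrow>
          \<exists>x. (\<lambda>n. nrm (x - of_rat (q n))) \<longlonglongrightarrow> 0"
    and finite_over_Qp: "\<exists>B. finite B \<and>
          (\<forall>x. \<exists>a. (\<forall>b\<in>B. a b \<in> Qp_in nrm) \<and> x = (\<Sum>b\<in>B. a b * b))"

definition ring_of_integers :: "('a::field_char_0 \<Rightarrow> real) \<Rightarrow> 'a set" where
  "ring_of_integers nrm = {x. nrm x \<le> 1}"

definition integer_units :: "('a::field_char_0 \<Rightarrow> real) \<Rightarrow> 'a set" where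
  "integer_units nrm = {x \<in> ring_of_integers nrm. \<exists>y \<in> ring_of_integers nrm. x * y = 1}"

definition uniformizer :: "('a::field_char_0 \<Rightarrow> real) \<Rightarrow> 'a \<Rightarrow> bool" where
  "uniformizer nrm \<pi> \<longleftrightarrow> {x. nrm x < 1} = (\<lambda>y. \<pi> * y) ` ring_of_integers nrm"

definition frakS :: "('a::field_char_0 \<Rightarrow> real) \<Rightarrow> 'a fps set" where
  "frakS nrm = {g. \<forall>n. fps_nth g n \<in> ring_of_integers nrm}"

definition E_ser :: "nat \<Rightarrow> 'a::field_char_0 fps" where
  "E_ser p = fps_X + fps_const (of_nat p)"

definition phi :: "nat \<Rightarrow> 'a::field_char_0 fps \<Rightarrow> 'a fps" where
  "phi p g = fps_compose g (fps_X ^ p)"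

text \<open>
  The series defining the rings below do not converge in the u-adic topology, since \<open>E\<close> has
  constant term \<open>p\<close>. Each coefficient of \<open>u\<close> converges in \<open>F\<close>.
\<close>

definition coeff_sums ::
  "('a::field_char_0 \<Rightarrow> real) \<Rightarrow> (nat \<Rightarrow> 'a fps) \<Rightarrow> 'a fps \<Rightarrow> bool" where
  "coeff_sums nrm t x \<longleftrightarrow>
     (\<forall>k. (\<lambda>N. nrm (fps_nth x k - (\<Sum>j<N. fps_nth (t j) k))) \<longlonglongrightarrow> 0)"

definition adjoin_series ::
  "('a::field_char_0 \<Rightarrow> real) \<Rightarrow> 'a fps \<Rightarrow> 'a fps set" where
  "adjoin_series nrm T =
     {x. \<exists>a. (\<forall>j. a j \<in> frakS nrm) \<and> coeff_sums nrm (\<lambda>j. a j * T ^ j) x}"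

definition S_ring :: "nat \<Rightarrow> ('a::field_char_0 \<Rightarrow> real) \<Rightarrow> 'a fps set" where
  "S_ring p nrm = adjoin_series nrm (fps_const (1 / of_nat p) * E_ser p ^ p)"

definition R_ring :: "nat \<Rightarrow> ('a::field_char_0 \<Rightarrow> real) \<Rightarrow> 'a \<Rightarrow> 'a fps set" where
  "R_ring p nrm \<pi> = adjoin_series nrm (fps_const (\<pi> / of_nat p) * E_ser p)"

text \<open>
  For \<open>p > 2\<close>, \<open>S_ring\<close> is contained in \<open>R_ring\<close> if and only if \<open>F\<close> is ramified: if \<open>p\<close> is a
  uniformizer, then \<open>R_ring\<close> is just \<open>frakS\<close>.
\<close>

definition Fil_S :: "nat \<Rightarrow> ('a::field_char_0 \<Rightarrow> real) \<Rightarrow> nat \<Rightarrow> 'a fps set" where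
  "Fil_S p nrm j = (\<lambda>x. E_ser p ^ j * x) ` S_ring p nrm"

definition I_ideal :: "nat \<Rightarrow> ('a::field_char_0 \<Rightarrow> real) \<Rightarrow> 'a \<Rightarrow> nat \<Rightarrow> 'a fps set" where
  "I_ideal p nrm \<pi> c =
     {fps_const (\<pi> * of_nat p ^ (c - 1)) * x + fps_const \<pi> * y + E_ser p * z | x y z.
        x \<in> S_ring p nrm \<and> y \<in> Fil_S p nrm (c * p) \<and> z \<in> Fil_S p nrm (c * p)}"

definition invert_p :: "nat \<Rightarrow> 'a::field_char_0 fps set \<Rightarrow> 'a fps set" where
  "invert_p p T = {x. \<exists>n. fps_const (of_nat p ^ n) * x \<in> T}"

definition Mat :: "'b set \<Rightarrow> ('b ^ 'n ^ 'n) set" where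
  "Mat T = {A. \<forall>i j. A $ i $ j \<in> T}"

definition GL :: "'b::comm_ring_1 set \<Rightarrow> ('b ^ 'n ^ 'n) set" where
  "GL T = {A \<in> Mat T. \<exists>B \<in> Mat T. A ** B = mat 1 \<and> B ** A = mat 1}"

definition Mat_height ::
  "nat \<Rightarrow> nat \<Rightarrow> 'a::field_char_0 fps set \<Rightarrow> ('a fps ^ 'n ^ 'n) set" where
  "Mat_height p h T =
     {A \<in> Mat T. \<exists>B \<in> Mat T. A ** B = mat (E_ser p ^ h) \<and> B ** A = mat (E_ser p ^ h)}"

definition diag2 :: "'a::field_char_0 \<Rightarrow> 'a \<Rightarrow> 'a fps ^ 2 ^ 2" where
  "diag2 x y = vector [vector [fps_const x, 0], vector [0, fps_const y]]"

definition phi_mat :: "nat \<Rightarrow> 'a::field_char_0 fps ^ 'n ^ 'n \<Rightarrow> 'a fps ^ 'n ^ 'n" where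
  "phi_mat p A = (\<chi> i j. phi p (A $ i $ j))"

text \<open>
  Tuples indexed by the integers modulo \<open>f\<close> are functions on \<open>nat\<close> of which only the values at
  \<open>i < f\<close> matter; the index \<open>i - 1\<close> is \<open>(i + f - 1) mod f\<close>.
\<close>

definition phi_conj :: "nat \<Rightarrow> nat \<Rightarrow> (nat \<Rightarrow> 'a::field_char_0 fps ^ 'n ^ 'n) \<Rightarrow>
    (nat \<Rightarrow> 'a fps ^ 'n ^ 'n) \<Rightarrow> nat \<Rightarrow> 'a fps ^ 'n ^ 'n" where
  "phi_conj p f X A = (\<lambda>i. X i ** A i ** matrix_inv (phi_mat p (X ((i + f - 1) mod f))))"

primrec phi_conj_seq :: "nat \<Rightarrow> nat \<Rightarrow> (nat \<Rightarrow> nat \<Rightarrow> 'a::field_char_0 fps ^ 'n ^ 'n) \<Rightarrow>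
    (nat \<Rightarrow> 'a fps ^ 'n ^ 'n) \<Rightarrow> nat \<Rightarrow> nat \<Rightarrow> 'a fps ^ 'n ^ 'n" where
  "phi_conj_seq p f X A 0 = A"
| "phi_conj_seq p f X A (Suc n) = phi_conj p f (X (Suc n)) (phi_conj_seq p f X A n)"

end

theory Submission
  imports Defs
begin

text \<open>
  Everything is read off from the \<open>u\<close>-coefficients: \<open>S\<close> lies in the ring of series with
  \<open>|x\<^sub>n| \<le> p ^ (n div p)\<close>, \<open>R\<close> is the ring of series with \<open>|x\<^sub>n| \<le> \<rho> ^ n\<close> for \<open>\<rho> = p |\<pi>|\<close>, and
  since \<open>E ^ p / p \<in> S\<close> the ideal \<open>I\<^sub>c\<close> is contained in \<open>\<pi> p ^ (c - 1) S\<close>.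

  First, the determinants of \<open>A\<^sub>m\<close> are \<open>E ^ k\<^sub>i\<close> times constants; these are integral, being the
  coefficients at \<open>u ^ k\<^sub>i\<close> with \<open>k\<^sub>i < c p\<close>, and the product of their norms over the cycle is 1, so
  they are units. Next, write \<open>A = D + C\<close> with \<open>D\<close> integral and \<open>C\<close> in \<open>\<pi> p ^ (c - 1) S\<close>, and divide:
  \<open>C = L + E ^ (c p) Q\<close>. Then \<open>L\<close> is divisible by \<open>\<pi>\<close>, and \<open>Z = - E ^ (c p) Q A\<^sup>-\<^sup>1\<close> satisfies
  \<open>(1 + Z) A = D + L\<close>. As \<open>c p - k \<ge> 2 c\<close> and \<open>\<phi>(E)\<close> is divisible by \<open>p\<close> in \<open>S\<close>, the matrix \<open>\<phi>(Z)\<close> is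
  so small that \<open>(D + L) \<phi>(1 + Z)\<^sup>-\<^sup>1\<close> has the same shape with \<open>c + 1\<close> in place of \<open>c\<close>. The factors
  \<open>1 + Z\<close> are invertible over \<open>R\<close> and their infinite product converges coefficientwise. That the
  determinant stays \<open>E ^ k\<close> times a unit at each step follows because an element \<open>h\<close> of \<open>R\<close> with
  \<open>E ^ k h\<close> integral is itself integral.
\<close>

section \<open>Completeness\<close>

context finite_ext_Qp
begin

section \<open>The norm as a non-archimedean absolute value\<close>

lemma p_ge_2: "p \<ge> 2"
  using prime_p prime_ge_2_nat by blast

lemma nrm_0 [simp]: "nrm 0 = 0"
  by (simp add: nrm_eq_0_iff)

lemma nrm_pos: "x \<noteq> 0 \<Longrightarrow> nrm x > 0"
  using nrm_nonneg[of x] nrm_eq_0_iff[of x] by linarith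

lemma nrm_1 [simp]: "nrm 1 = 1"
proof -
  have "nrm 1 * nrm 1 = nrm 1" by (metis nrm_mult mult_1)
  moreover have "nrm 1 \<noteq> 0" by (simp add: nrm_eq_0_iff)
  ultimately show ?thesis by simp
qed

lemma nrm_minus [simp]: "nrm (- x) = nrm x"
proof -
  have "nrm (-1) * nrm (-1) = 1" using nrm_mult[of "-1" "-1"] by simp
  hence "(nrm (-1) - 1) * (nrm (-1) + 1) = 0" by (simp add: algebra_simps)
  hence "nrm (-1) = 1" using nrm_nonneg[of "-1"] by auto
  thus ?thesis using nrm_mult[of "-1" x] by simp
qed

lemma nrm_diff_commute: "nrm (x - y) = nrm (y - x)"
  by (metis minus_diff_eq nrm_minus)

lemma nrm_diff_le_max: "nrm (x - y) \<le> max (nrm x) (nrm y)"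
  using nrm_add_le_max[of x "- y"] by simp

lemma nrm_add_leI: "nrm x \<le> e \<Longrightarrow> nrm y \<le> e \<Longrightarrow> nrm (x + y) \<le> e"
  using nrm_add_le_max[of x y] by linarith

lemma nrm_diff_leI: "nrm x \<le> e \<Longrightarrow> nrm y \<le> e \<Longrightarrow> nrm (x - y) \<le> e"
  using nrm_diff_le_max[of x y] by linarith

lemma nrm_add_lessI: "nrm x < e \<Longrightarrow> nrm y < e \<Longrightarrow> nrm (x + y) < e"
  using nrm_add_le_max[of x y] by linarith

lemma nrm_triangle_max: "nrm (x - z) \<le> max (nrm (x - y)) (nrm (y - z))"
  using nrm_add_le_max[of "x - y" "y - z"] by simp

lemma nrm_eq_of_close: "nrm (x - y) < nrm x \<Longrightarrow> nrm y = nrm x"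
  using nrm_diff_le_max[of x "x - y"] nrm_add_le_max[of "x - y" y] by simp

lemma nrm_power: "nrm (x ^ n) = nrm x ^ n"
  by (induction n) (simp_all add: nrm_mult)

lemma nrm_divide: "nrm (x / y) = nrm x / nrm y"
proof (cases "y = 0")
  case False
  hence "nrm (x / y) * nrm y = nrm x" by (metis nrm_mult nonzero_divide_eq_eq)
  thus ?thesis using False by (simp add: nrm_eq_0_iff field_simps)
qed simp

lemma nrm_sum_leI:
  assumes "\<And>i. i \<in> I \<Longrightarrow> nrm (g i) \<le> e" "0 \<le> e"
  shows "nrm (\<Sum>i\<in>I. g i) \<le> e"
  using assms
proof (induction I rule: infinite_finite_induct)
  case (insert x F)
  show ?case using insert by (simp, intro nrm_add_leI) auto
qed simp_all

lemma nrm_p: "nrm (of_nat p) = 1 / real p"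
proof -
  have "multiplicity (int p) (int p) = 1"
    using prime_p by (intro multiplicity_self) auto
  hence "padic_abs p (of_nat p) = real p powi (-1)"
    using prime_p by (auto simp: padic_abs_def quotient_of_int[of "int p", simplified])
  thus ?thesis using nrm_of_rat[of "of_nat p"] by (simp add: power_int_minus divide_inverse)
qed

section \<open>Convergence and Cauchy sequences for the norm\<close>

definition tends :: "(nat \<Rightarrow> 'a) \<Rightarrow> 'a \<Rightarrow> bool" where
  "tends s x \<longleftrightarrow> (\<lambda>n. nrm (s n - x)) \<longlonglongrightarrow> 0"

definition fundamental :: "(nat \<Rightarrow> 'a) \<Rightarrow> bool" where
  "fundamental s \<longleftrightarrow> (\<forall>e>0. \<exists>N. \<forall>m\<ge>N. \<forall>n\<ge>N. nrm (s m - s n) < e)"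

lemma tends_iff: "tends s x \<longleftrightarrow> (\<forall>e>0. \<exists>N. \<forall>n\<ge>N. nrm (s n - x) < e)"
  by (simp add: tends_def LIMSEQ_iff abs_of_nonneg nrm_nonneg)

lemma tends_const: "tends (\<lambda>_. x) x"
  by (simp add: tends_def)

lemma tends_add:
  assumes "tends s x" "tends t y"
  shows "tends (\<lambda>n. s n + t n) (x + y)"
  unfolding tends_iff
proof (intro allI impI)
  fix e :: real assume "e > 0"
  then obtain M N where "\<forall>n\<ge>M. nrm (s n - x) < e" "\<forall>n\<ge>N. nrm (t n - y) < e"
    using assms unfolding tends_iff by blast
  hence "\<forall>n\<ge>max M N. nrm ((s n - x) + (t n - y)) < e" by (auto intro!: nrm_add_lessI)
  thus "\<exists>N. \<forall>n\<ge>N. nrm (s n + t n - (x + y)) < e" unfolding add_diff_add[symmetric] by blast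
qed

lemma tends_cmult:
  assumes "tends s x"
  shows "tends (\<lambda>n. c * s n) (c * x)"
proof -
  have "(\<lambda>n. nrm c * nrm (s n - x)) \<longlonglongrightarrow> nrm c * 0"
    using assms unfolding tends_def by (intro tendsto_mult tendsto_const)
  thus ?thesis unfolding tends_def by (simp add: nrm_mult[symmetric] right_diff_distrib)
qed

lemma tends_minus: "tends s x \<Longrightarrow> tends (\<lambda>n. - s n) (- x)"
  using tends_cmult[of s x "-1"] by simp

lemma tends_diff: "tends s x \<Longrightarrow> tends t y \<Longrightarrow> tends (\<lambda>n. s n - t n) (x - y)"
  using tends_add[of s x "\<lambda>n. - t n" "- y"] tends_minus[of t y] by simp

lemma tends_unique:
  assumes "tends s x" "tends s y"
  shows "x = y"
proof -
  have "tends (\<lambda>n. s n - s n) (x - y)" using assms tends_diff by blast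
  hence "(\<lambda>n. nrm (x - y)) \<longlonglongrightarrow> 0" unfolding tends_def by (simp add: nrm_diff_commute)
  thus ?thesis by (simp add: LIMSEQ_const_iff nrm_eq_0_iff)
qed

lemma tends_nrm_le:
  assumes "tends s x" "\<And>n. nrm (s n) \<le> e"
  shows "nrm x \<le> e"
proof (rule field_le_epsilon)
  fix d :: real assume "d > 0"
  then obtain N where "nrm (s N - x) < d" using assms(1) unfolding tends_iff by blast
  moreover have "nrm x \<le> max (nrm (s N)) (nrm (s N - x))"
    using nrm_diff_le_max[of "s N" "s N - x"] by simp
  ultimately show "nrm x \<le> e + d"
    using assms(2)[of N] nrm_nonneg[of "s N"] \<open>d > 0\<close> by linarith
qed

lemma tends_nrm_bounded: "tends s x \<Longrightarrow> \<exists>M. \<forall>n. nrm (s n) \<le> M"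
proof -
  assume "tends s x"
  hence "convergent (\<lambda>n. nrm (s n - x))" unfolding tends_def convergent_def by blast
  hence "Bseq (\<lambda>n. nrm (s n - x))" by (rule convergent_imp_Bseq)
  then obtain K where "\<And>n. nrm (s n - x) \<le> K"
    by (auto simp: Bseq_def abs_of_nonneg nrm_nonneg)
  hence "nrm (s n) \<le> max K (nrm x)" for n
    using nrm_add_le_max[of "s n - x" x] by (smt (verit) diff_add_cancel)
  thus ?thesis by blast
qed

lemma tends_mult:
  assumes "tends s x" "tends t y"
  shows "tends (\<lambda>n. s n * t n) (x * y)"
proof -
  obtain M where M: "\<And>n. nrm (s n) \<le> M" using tends_nrm_bounded assms(1) by blast
  have "tends (\<lambda>n. s n * (t n - y)) 0"
    unfolding tends_def
  proof (rule tendsto_sandwich[of "\<lambda>_. 0" _ _ "\<lambda>n. M * nrm (t n - y)"])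
    show "(\<lambda>n. M * nrm (t n - y)) \<longlonglongrightarrow> 0"
      using assms(2) unfolding tends_def by (rule tendsto_mult_right_zero)
  qed (use M nrm_nonneg in \<open>auto simp: nrm_mult intro!: always_eventually mult_right_mono\<close>)
  hence "tends (\<lambda>n. s n * (t n - y) + y * s n) (0 + y * x)"
    by (intro tends_add tends_cmult assms(1))
  thus ?thesis by (simp add: algebra_simps)
qed

lemma tends_sum:
  assumes "\<And>i. i \<in> I \<Longrightarrow> tends (s i) (x i)"
  shows "tends (\<lambda>n. \<Sum>i\<in>I. s i n) (\<Sum>i\<in>I. x i)"
  using assms
  by (induction I rule: infinite_finite_induct) (auto simp: tends_const intro!: tends_add)

lemma tends_fundamental:
  assumes "tends s x" shows "fundamental s"
  unfolding fundamental_def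
proof (intro allI impI)
  fix e :: real assume "e > 0"
  then obtain N where N: "\<forall>n\<ge>N. nrm (s n - x) < e" using assms unfolding tends_iff by blast
  hence "nrm (s m - s n) < e" if "m \<ge> N" "n \<ge> N" for m n
    using nrm_triangle_max[of "s m" "s n" x] that
    by (metis (no_types) max_less_iff_conj nrm_diff_commute order_le_less_trans)
  thus "\<exists>N. \<forall>m\<ge>N. \<forall>n\<ge>N. nrm (s m - s n) < e" by blast
qed

section \<open>The closure of the rationals as a complete subfield\<close>

lemma Qp_in_iff: "x \<in> Qp_in nrm \<longleftrightarrow> (\<exists>q :: nat \<Rightarrow> rat. tends (\<lambda>n. of_rat (q n)) x)"
  by (simp add: Qp_in_def tends_def nrm_diff_commute)

lemma Qp_inI: "tends (\<lambda>n. of_rat (q n)) x \<Longrightarrow> x \<in> Qp_in nrm"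
  unfolding Qp_in_iff by (intro exI[of _ q])

lemma Qp_in_add: "x \<in> Qp_in nrm \<Longrightarrow> y \<in> Qp_in nrm \<Longrightarrow> x + y \<in> Qp_in nrm"
proof -
  assume "x \<in> Qp_in nrm" "y \<in> Qp_in nrm"
  then obtain q r where "tends (\<lambda>n. of_rat (q n)) x" "tends (\<lambda>n. of_rat (r n)) y"
    unfolding Qp_in_iff by blast
  hence "tends (\<lambda>n. of_rat (q n + r n)) (x + y)" unfolding of_rat_add by (rule tends_add)
  thus ?thesis by (rule Qp_inI)
qed

lemma Qp_in_mult: "x \<in> Qp_in nrm \<Longrightarrow> y \<in> Qp_in nrm \<Longrightarrow> x * y \<in> Qp_in nrm"
proof -
  assume "x \<in> Qp_in nrm" "y \<in> Qp_in nrm"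
  then obtain q r where "tends (\<lambda>n. of_rat (q n)) x" "tends (\<lambda>n. of_rat (r n)) y"
    unfolding Qp_in_iff by blast
  hence "tends (\<lambda>n. of_rat (q n * r n)) (x * y)" unfolding of_rat_mult by (rule tends_mult)
  thus ?thesis by (rule Qp_inI)
qed

lemma Qp_in_of_rat: "of_rat q \<in> Qp_in nrm"
  unfolding Qp_in_iff by (intro exI[of _ "\<lambda>_. q"] tends_const)

lemma Qp_in_minus: "x \<in> Qp_in nrm \<Longrightarrow> - x \<in> Qp_in nrm"
  using Qp_in_mult[OF Qp_in_of_rat[of "-1"]] by simp

lemma Qp_in_diff: "x \<in> Qp_in nrm \<Longrightarrow> y \<in> Qp_in nrm \<Longrightarrow> x - y \<in> Qp_in nrm"
  using Qp_in_add[of x "- y"] Qp_in_minus by simp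

lemma Qp_in_inverse:
  assumes "x \<in> Qp_in nrm" shows "inverse x \<in> Qp_in nrm"
proof (cases "x = 0")
  case False
  obtain q where q: "tends (\<lambda>n. of_rat (q n)) x" using assms unfolding Qp_in_iff by blast
  obtain N where "\<forall>n\<ge>N. nrm (of_rat (q n) - x) < nrm x"
    using q nrm_pos[OF False] unfolding tends_iff by blast
  \<comment> \<open>The norms of the approximations are eventually constant, so the difference of
    the inverses has a denominator of fixed norm.\<close>
  hence eq: "nrm (of_rat (q n)) = nrm x" if "n \<ge> N" for n
    using that nrm_eq_of_close by (metis nrm_diff_commute)
  have "tends (\<lambda>n. of_rat (inverse (q n))) (inverse x)"
    unfolding tends_def
  proof (rule Lim_transform_eventually)
    have "(\<lambda>n. nrm (of_rat (q n) - x) / (nrm x * nrm x)) \<longlonglongrightarrow> 0 / (nrm x * nrm x)"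
      using q False unfolding tends_def
      by (intro tendsto_divide tendsto_const) (auto simp: nrm_eq_0_iff)
    thus "(\<lambda>n. nrm (of_rat (q n) - x) / (nrm x * nrm x)) \<longlonglongrightarrow> 0" by simp
    have "nrm (of_rat (q n) - x) / (nrm x * nrm x) = nrm (of_rat (inverse (q n)) - inverse x)"
      if "n \<ge> N" for n
    proof -
      have "(of_rat (q n) :: 'a) \<noteq> 0" using eq[OF that] False by (metis nrm_eq_0_iff)
      hence "of_rat (inverse (q n)) - inverse x = (x - of_rat (q n)) / (of_rat (q n) * x)"
        using False unfolding of_rat_inverse by (simp add: divide_simps)
      thus ?thesis using eq[OF that] by (simp add: nrm_divide nrm_mult nrm_diff_commute)
    qed
    thus "\<forall>\<^sub>F n in sequentially. nrm (of_rat (q n) - x) / (nrm x * nrm x)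
        = nrm (of_rat (inverse (q n)) - inverse x)"
      using eventually_sequentially by blast
  qed
  thus ?thesis by (rule Qp_inI)
qed (use assms in simp)

text \<open>Each term is replaced by a rational number at distance below \<open>1 / Suc n\<close>.
  The rational sequence is again Cauchy, so \<open>Qp_complete\<close> gives it a limit, which the
  original sequence shares.\<close>

lemma Qp_in_complete:
  assumes "fundamental s" "\<And>n. s n \<in> Qp_in nrm"
  shows "\<exists>x\<in>Qp_in nrm. tends s x"
proof -
  have "\<exists>q. nrm (s n - of_rat q) < 1 / real (Suc n)" for n
  proof -
    obtain q where "tends (\<lambda>k. of_rat (q k)) (s n)" using assms(2) unfolding Qp_in_iff by blast
    then obtain k where "nrm (of_rat (q k) - s n) < 1 / real (Suc n)"
      unfolding tends_iff by (meson le_refl of_nat_0_less_iff zero_less_Suc zero_less_divide_1_iff)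
    thus ?thesis by (metis nrm_diff_commute)
  qed
  then obtain q where q: "\<And>n. nrm (s n - of_rat (q n)) < 1 / real (Suc n)" by metis
  have close: "tends (\<lambda>n. s n - of_rat (q n)) 0"
    unfolding tends_def
    by (rule tendsto_sandwich[OF _ _ tendsto_const LIMSEQ_inverse_real_of_nat])
      (use q nrm_nonneg in \<open>auto simp: field_simps less_imp_le intro!: always_eventually\<close>)
  have "\<forall>e>0. \<exists>N. \<forall>m\<ge>N. \<forall>n\<ge>N. padic_abs p (q m - q n) < e"
  proof (intro allI impI)
    fix e :: real assume "e > 0"
    then obtain M N where MN: "\<forall>m\<ge>M. \<forall>n\<ge>M. nrm (s m - s n) < e"
        "\<forall>n\<ge>N. nrm (s n - of_rat (q n) - 0) < e"
      using assms(1) close unfolding fundamental_def tends_iff by meson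
    have "nrm (of_rat (q m - q n)) < e" if "m \<ge> max M N" "n \<ge> max M N" for m n
    proof -
      have "(of_rat (q m - q n) :: 'a)
          = - (s m - of_rat (q m)) + ((s n - of_rat (q n)) + (s m - s n))"
        by (simp add: of_rat_diff)
      also have "nrm \<dots> < e" using MN that by (intro nrm_add_lessI) (auto simp: nrm_diff_commute)
      finally show ?thesis .
    qed
    thus "\<exists>N. \<forall>m\<ge>N. \<forall>n\<ge>N. padic_abs p (q m - q n) < e" unfolding nrm_of_rat by blast
  qed
  then obtain x where x: "tends (\<lambda>n. of_rat (q n)) x"
    using Qp_complete[of q] unfolding tends_def by (auto simp: nrm_diff_commute)
  have "tends (\<lambda>n. (s n - of_rat (q n)) + of_rat (q n)) (0 + x)"
    using close x tends_add by blast
  thus ?thesis using x Qp_in_iff by auto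
qed

section \<open>Completeness of finite-dimensional spaces over the p-adic numbers\<close>

definition Qp_span :: "'a set \<Rightarrow> 'a set" where
  "Qp_span B = {\<Sum>b\<in>B. a b * b | a. \<forall>b\<in>B. a b \<in> Qp_in nrm}"

lemma Qp_span_diff:
  assumes "x \<in> Qp_span B" "y \<in> Qp_span B" shows "x - y \<in> Qp_span B"
proof -
  obtain a a' where "x = (\<Sum>b\<in>B. a b * b)" "y = (\<Sum>b\<in>B. a' b * b)"
      "\<forall>b\<in>B. a b \<in> Qp_in nrm" "\<forall>b\<in>B. a' b \<in> Qp_in nrm"
    using assms unfolding Qp_span_def by blast
  thus ?thesis unfolding Qp_span_def
    by (auto intro!: exI[of _ "\<lambda>b. a b - a' b"] simp: Qp_in_diff sum_subtractf left_diff_distrib)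
qed

lemma Qp_span_scale:
  assumes "x \<in> Qp_span B" "c \<in> Qp_in nrm" shows "c * x \<in> Qp_span B"
proof -
  obtain a where "x = (\<Sum>b\<in>B. a b * b)" "\<forall>b\<in>B. a b \<in> Qp_in nrm"
    using assms unfolding Qp_span_def by blast
  thus ?thesis unfolding Qp_span_def using assms(2)
    by (auto intro!: exI[of _ "\<lambda>b. c * a b"] simp: Qp_in_mult sum_distrib_left mult.assoc)
qed

lemma Qp_span_insert:
  assumes "finite B" "b \<notin> B"
  shows "x \<in> Qp_span (insert b B) \<longleftrightarrow> (\<exists>v\<in>Qp_span B. \<exists>a\<in>Qp_in nrm. x = v + a * b)"
proof
  assume "x \<in> Qp_span (insert b B)"
  then obtain a where a: "x = (\<Sum>b\<in>insert b B. a b * b)" "\<forall>b\<in>insert b B. a b \<in> Qp_in nrm"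
    unfolding Qp_span_def by blast
  hence "x = (\<Sum>b\<in>B. a b * b) + a b * b" using assms by simp
  moreover have "(\<Sum>b\<in>B. a b * b) \<in> Qp_span B" unfolding Qp_span_def using a(2) by auto
  ultimately show "\<exists>v\<in>Qp_span B. \<exists>a\<in>Qp_in nrm. x = v + a * b" using a(2) by auto
next
  assume "\<exists>v\<in>Qp_span B. \<exists>a\<in>Qp_in nrm. x = v + a * b"
  then obtain a c where a: "x = (\<Sum>b\<in>B. a b * b) + c * b" "\<forall>b\<in>B. a b \<in> Qp_in nrm" "c \<in> Qp_in nrm"
    unfolding Qp_span_def by blast
  have "(\<Sum>y\<in>B. (a(b := c)) y * y) = (\<Sum>y\<in>B. a y * y)"
    using assms by (intro sum.cong) auto
  hence "x = (\<Sum>y\<in>insert b B. (a(b := c)) y * y)" using a(1) assms by simp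
  moreover have "\<forall>y\<in>insert b B. (a(b := c)) y \<in> Qp_in nrm" using a by simp
  ultimately show "x \<in> Qp_span (insert b B)" unfolding Qp_span_def by blast
qed

text \<open>Induction on \<open>B\<close>. If the new vector \<open>b\<close> lies outside the old
  span, that span is complete, hence closed, and \<open>b\<close> has positive distance from it. The
  coefficient of \<open>b\<close> is then controlled by the norm of the whole vector, and a Cauchy
  sequence splits into Cauchy sequences of components.\<close>

lemma Qp_span_complete:
  assumes "finite B" "fundamental s" "\<And>n. s n \<in> Qp_span B"
  shows "\<exists>x\<in>Qp_span B. tends s x"
  using assms
proof (induction B arbitrary: s rule: finite_induct)
  case empty
  hence "s = (\<lambda>_. 0)" unfolding Qp_span_def by auto
  thus ?case using tends_const[of 0] unfolding Qp_span_def by auto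
next
  case (insert b B)
  show ?case
  proof (cases "b \<in> Qp_span B")
    case True
    have "Qp_span (insert b B) \<subseteq> Qp_span B"
    proof
      fix x assume "x \<in> Qp_span (insert b B)"
      then obtain v a where "v \<in> Qp_span B" "a \<in> Qp_in nrm" "x = v + a * b"
        using Qp_span_insert insert.hyps by blast
      hence "x = v - (- a) * b" "(- a) * b \<in> Qp_span B"
        using Qp_span_scale[OF True Qp_in_minus] by auto
      thus "x \<in> Qp_span B" using \<open>v \<in> Qp_span B\<close> Qp_span_diff by blast
    qed
    hence "s n \<in> Qp_span B" for n using insert.prems(2) by blast
    from insert.IH[OF insert.prems(1) this] obtain x where x: "x \<in> Qp_span B" "tends s x" by blast
    have "x = x + of_rat 0 * b" by simp
    hence "x \<in> Qp_span (insert b B)"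
      using Qp_span_insert[OF insert.hyps] x(1) Qp_in_of_rat by blast
    thus ?thesis using x(2) by blast
  next
    case False
    \<comment> \<open>Otherwise \<open>b\<close> would be a limit of elements of the span, and the
      induction hypothesis would put it there.\<close>
    have "\<exists>d>0. \<forall>v\<in>Qp_span B. d \<le> nrm (v - b)"
    proof (rule ccontr)
      assume "\<not> ?thesis"
      hence "\<exists>v\<in>Qp_span B. nrm (v - b) < 1 / real (Suc n)" for n
        by (meson not_le of_nat_0_less_iff zero_less_Suc zero_less_divide_1_iff)
      then obtain v where v: "\<And>n. v n \<in> Qp_span B" "\<And>n. nrm (v n - b) < 1 / real (Suc n)"
        by metis
      have t: "tends v b" unfolding tends_def
        by (rule tendsto_sandwich[OF _ _ tendsto_const LIMSEQ_inverse_real_of_nat])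
          (use v nrm_nonneg in \<open>auto simp: field_simps less_imp_le intro!: always_eventually\<close>)
      then obtain x where "x \<in> Qp_span B" "tends v x"
        using insert.IH[of v] tends_fundamental v(1) by blast
      thus False using False t tends_unique by blast
    qed
    then obtain d where d: "d > 0" "\<And>v. v \<in> Qp_span B \<Longrightarrow> d \<le> nrm (v - b)" by blast
    \<comment> \<open>Scaling by \<open>- inverse a\<close> turns \<open>v + a * b\<close> into the
      difference of an element of the span and \<open>b\<close>.\<close>
    have bound: "nrm a * d \<le> nrm (v + a * b)" if "v \<in> Qp_span B" "a \<in> Qp_in nrm" for v a
    proof (cases "a = 0")
      case False
      have "(- inverse a) * v \<in> Qp_span B" using that Qp_span_scale Qp_in_inverse Qp_in_minus by blast
      hence "nrm a * d \<le> nrm a * nrm ((- inverse a) * v - b)"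
        using d(2) nrm_nonneg by (intro mult_left_mono) auto
      also have "\<dots> = nrm (a * ((- inverse a) * v - b))" by (simp only: nrm_mult)
      also have "a * ((- inverse a) * v - b) = - (v + a * b)" using False by (simp add: field_simps)
      finally show ?thesis by (simp only: nrm_minus)
    qed (simp add: nrm_nonneg)
    obtain v a where va: "\<And>n. v n \<in> Qp_span B" "\<And>n. a n \<in> Qp_in nrm" "\<And>n. s n = v n + a n * b"
      using insert.prems(2) unfolding Qp_span_insert[OF insert.hyps] by metis
    have "fundamental a" unfolding fundamental_def
    proof (intro allI impI)
      fix e :: real assume "e > 0"
      hence "e * d > 0" using d(1) by simp
      then obtain N where N: "\<forall>m\<ge>N. \<forall>n\<ge>N. nrm (s m - s n) < e * d"
        using insert.prems(1) unfolding fundamental_def by meson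
      have "nrm (a m - a n) < e" if "m \<ge> N" "n \<ge> N" for m n
      proof -
        have "nrm (a m - a n) * d \<le> nrm ((v m - v n) + (a m - a n) * b)"
          by (intro bound Qp_span_diff Qp_in_diff va)
        also have "\<dots> = nrm (s m - s n)" unfolding va(3) by (simp add: algebra_simps)
        also have "\<dots> < e * d" using N that by blast
        finally show ?thesis using d(1) by simp
      qed
      thus "\<exists>N. \<forall>m\<ge>N. \<forall>n\<ge>N. nrm (a m - a n) < e" by blast
    qed
    then obtain a' where a': "a' \<in> Qp_in nrm" "tends a a'" using Qp_in_complete[of a] va(2) by blast
    have "fundamental v" unfolding fundamental_def
    proof (intro allI impI)
      fix e :: real assume e: "e > 0"
      have "fundamental (\<lambda>n. b * a n)" using tends_fundamental[OF tends_cmult[OF a'(2)]] .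
      then obtain M N where "\<forall>m\<ge>M. \<forall>n\<ge>M. nrm (s m - s n) < e"
          "\<forall>m\<ge>N. \<forall>n\<ge>N. nrm (b * a m - b * a n) < e"
        using insert.prems(1) e unfolding fundamental_def by meson
      hence "\<forall>m\<ge>max M N. \<forall>n\<ge>max M N. nrm ((s m - s n) + (b * a n - b * a m)) < e"
        by (intro allI impI nrm_add_lessI) auto
      moreover have "(s m - s n) + (b * a n - b * a m) = v m - v n" for m n
        unfolding va(3) by (simp add: algebra_simps)
      ultimately show "\<exists>N. \<forall>m\<ge>N. \<forall>n\<ge>N. nrm (v m - v n) < e" by (intro exI[of _ "max M N"]) simp
    qed
    then obtain v' where v': "v' \<in> Qp_span B" "tends v v'" using insert.IH[of v] va(1) by blast
    have "tends (\<lambda>n. v n + b * a n) (v' + b * a')" by (intro tends_add tends_cmult v'(2) a'(2))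
    hence "tends s (v' + a' * b)" by (simp add: va(3)[abs_def] mult.commute)
    moreover have "v' + a' * b \<in> Qp_span (insert b B)"
      unfolding Qp_span_insert[OF insert.hyps] using v'(1) a'(1) by blast
    ultimately show ?thesis by blast
  qed
qed

theorem fundamental_converges:
  assumes "fundamental s" shows "\<exists>x. tends s x"
proof -
  obtain B where B: "finite B" "\<forall>x. \<exists>a. (\<forall>b\<in>B. a b \<in> Qp_in nrm) \<and> x = (\<Sum>b\<in>B. a b * b)"
    using finite_over_Qp by blast
  hence "x \<in> Qp_span B" for x unfolding Qp_span_def by blast
  thus ?thesis using Qp_span_complete[OF B(1) assms] by blast
qed

text \<open>By the ultrametric inequality a long difference is no larger than the largest
  consecutive one, so null consecutive differences already make the sequence Cauchy.\<close>

lemma tends_of_null_differences: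
  assumes "(\<lambda>n. nrm (s (Suc n) - s n)) \<longlonglongrightarrow> 0"
  shows "\<exists>x. tends s x"
proof (rule fundamental_converges, unfold fundamental_def, intro allI impI)
  fix e :: real assume "e > 0"
  then obtain N where N: "\<And>n. n \<ge> N \<Longrightarrow> nrm (s (Suc n) - s n) < e"
    using assms by (auto simp: LIMSEQ_iff abs_of_nonneg nrm_nonneg)
  have *: "nrm (s n - s N) < e" if "n \<ge> N" for n
    using that
  proof (induction n rule: dec_induct)
    case base show ?case using \<open>e > 0\<close> by simp
  next
    case (step n)
    thus ?case using nrm_add_lessI[OF N[of n] step.IH] by simp
  qed
  have "nrm (s m - s n) < e" if "m \<ge> N" "n \<ge> N" for m n
    using nrm_add_lessI[of "s m - s N" e "s N - s n"] *[OF that(1)] *[OF that(2)]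
    by (simp add: nrm_diff_commute)
  thus "\<exists>N. \<forall>m\<ge>N. \<forall>n\<ge>N. nrm (s m - s n) < e" by blast
qed

end

section \<open>Series of bounded growth and division by \<open>E\<close>\<close>

context finite_ext_Qp
begin

text \<open>The rings and ideals of the proof are handled through such bounds: the constant 1 gives
  \<open>frakS\<close>, a power \<open>b ^ n\<close> means Gauss norm at most 1 on the disc of
  radius \<open>1 / b\<close>, and a factor \<open>nrm a\<close> in front of \<open>w\<close>
  expresses divisibility by a nonzero constant \<open>a\<close>.\<close>

definition growth :: "(nat \<Rightarrow> real) \<Rightarrow> 'a fps set" where
  "growth w = {x. \<forall>n. nrm (fps_nth x n) \<le> w n}"

lemma growthI: "(\<And>n. nrm (fps_nth x n) \<le> w n) \<Longrightarrow> x \<in> growth w"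
  by (simp add: growth_def)

lemma growthD: "x \<in> growth w \<Longrightarrow> nrm (fps_nth x n) \<le> w n"
  by (simp add: growth_def)

lemma growth_weight_nonneg: "x \<in> growth w \<Longrightarrow> 0 \<le> w n"
  using growthD[of x w n] nrm_nonneg order_trans by blast

lemma growth_mono: "x \<in> growth w \<Longrightarrow> (\<And>n. w n \<le> w' n) \<Longrightarrow> x \<in> growth w'"
  unfolding growth_def by (auto intro: order_trans)

lemma growth_zero: "(\<And>n. 0 \<le> w n) \<Longrightarrow> 0 \<in> growth w"
  by (simp add: growth_def)

lemma growth_add: "x \<in> growth w \<Longrightarrow> y \<in> growth w \<Longrightarrow> x + y \<in> growth w"
  unfolding growth_def by (auto intro: nrm_add_leI)

lemma growth_minus: "x \<in> growth w \<Longrightarrow> - x \<in> growth w"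
  unfolding growth_def by simp

lemma growth_diff: "x \<in> growth w \<Longrightarrow> y \<in> growth w \<Longrightarrow> x - y \<in> growth w"
  unfolding growth_def by (auto intro: nrm_diff_leI)

lemma growth_const: "nrm c \<le> w 0 \<Longrightarrow> (\<And>n. 0 \<le> w n) \<Longrightarrow> fps_const c \<in> growth w"
  by (intro growthI) auto

lemma growth_one: "1 \<le> w 0 \<Longrightarrow> (\<And>n. 0 \<le> w n) \<Longrightarrow> 1 \<in> growth w"
  using growth_const[of 1 w] by simp

lemma growth_sum:
  assumes "\<And>i. i \<in> I \<Longrightarrow> x i \<in> growth w" "\<And>n. 0 \<le> w n"
  shows "(\<Sum>i\<in>I. x i) \<in> growth w"
  using assms
  by (induction I rule: infinite_finite_induct) (auto intro: growth_zero growth_add)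

lemma growth_mult:
  assumes "x \<in> growth w" "y \<in> growth w'" "\<And>a b. w a * w' b \<le> w'' (a + b)"
  shows "x * y \<in> growth w''"
proof (rule growthI)
  fix n
  have "nrm (fps_nth x i * fps_nth y (n - i)) \<le> w'' n" if "i \<in> {0..n}" for i
  proof -
    have "nrm (fps_nth x i * fps_nth y (n - i)) \<le> w i * w' (n - i)"
      unfolding nrm_mult using assms(1,2) nrm_nonneg
      by (intro mult_mono growthD) (auto intro: growth_weight_nonneg)
    also have "\<dots> \<le> w'' n" using assms(3)[of i "n - i"] that by simp
    finally show ?thesis .
  qed
  moreover have "0 \<le> w'' n"
    using assms(3)[of 0 n] growth_weight_nonneg[OF assms(1)] growth_weight_nonneg[OF assms(2)]
    by (metis add_0 mult_nonneg_nonneg order_trans)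
  ultimately show "nrm (fps_nth (x * y) n) \<le> w'' n"
    unfolding fps_mult_nth by (rule nrm_sum_leI)
qed

text \<open>Supermultiplicativity closes \<open>growth w\<close> under products, and the lower bound
  1 makes it contain \<open>frakS\<close>.\<close>

definition weight :: "(nat \<Rightarrow> real) \<Rightarrow> bool" where
  "weight w \<longleftrightarrow> (\<forall>n. 1 \<le> w n) \<and> (\<forall>a b. w a * w b \<le> w (a + b))"

lemma weight_ge_1: "weight w \<Longrightarrow> 1 \<le> w n"
  and weight_mult_le: "weight w \<Longrightarrow> w a * w b \<le> w (a + b)"
  by (simp_all add: weight_def)

lemma weight_nonneg: "weight w \<Longrightarrow> 0 \<le> w n"
  using weight_ge_1[of w n] by linarith

lemma weight_const_1: "weight (\<lambda>_. 1)"
  by (simp add: weight_def)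

lemma weight_power: "1 \<le> b \<Longrightarrow> weight (\<lambda>n. b ^ n)"
  by (simp add: weight_def power_add)

lemma growth_weight_mult: "weight w \<Longrightarrow> x \<in> growth w \<Longrightarrow> y \<in> growth w \<Longrightarrow> x * y \<in> growth w"
  by (rule growth_mult[of x w y w]) (auto simp: weight_mult_le)

lemma growth_weight_scaled_mult:
  assumes "weight w" "x \<in> growth (\<lambda>n. a * w n)" "y \<in> growth (\<lambda>n. b * w n)" "0 \<le> a" "0 \<le> b"
  shows "x * y \<in> growth (\<lambda>n. a * b * w n)"
proof (rule growth_mult[OF assms(2,3)])
  fix i j
  have "a * b * (w i * w j) \<le> a * b * w (i + j)"
    using assms by (intro mult_left_mono weight_mult_le) auto
  thus "a * w i * (b * w j) \<le> a * b * w (i + j)" by (simp add: ac_simps)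
qed

lemma growth_weight_scaled_power:
  assumes "weight w" "x \<in> growth (\<lambda>n. a * w n)" "0 \<le> a"
  shows "x ^ j \<in> growth (\<lambda>n. a ^ j * w n)"
proof (induction j)
  case 0
  show ?case using assms(1) by (auto intro!: growth_one simp: weight_ge_1 weight_nonneg)
next
  case (Suc j)
  thus ?case using growth_weight_scaled_mult[OF assms(1,2) Suc] assms(3) by simp
qed

lemma growth_weight_power: "weight w \<Longrightarrow> x \<in> growth w \<Longrightarrow> x ^ j \<in> growth w"
  using growth_weight_scaled_power[of w x 1 j] by simp

text \<open>The recursion for the coefficients of the inverse divides only by the constant
  coefficient, whose norm is 1, so the bound is inherited by induction on the degree.\<close>

lemma growth_weight_inverse:
  assumes "weight w" "x \<in> growth w" "nrm (fps_nth x 0) = 1"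
  shows "inverse x \<in> growth w"
proof (rule growthI)
  fix n
  have x0: "fps_nth x 0 \<noteq> 0" using assms(3) by auto
  show "nrm (fps_nth (inverse x) n) \<le> w n"
  proof (induction n rule: less_induct)
    case (less n)
    show ?case
    proof (cases "n = 0")
      case True
      have "nrm (inverse (fps_nth x 0)) = 1"
        using nrm_divide[of 1 "fps_nth x 0"] assms(3) by (simp add: divide_inverse)
      thus ?thesis using True weight_ge_1[OF assms(1), of 0] x0 by simp
    next
      case False
      have "fps_nth (x * inverse x) n = 0" using x0 False by (simp add: inverse_mult_eq_1')
      hence "fps_nth x 0 * fps_nth (inverse x) n
          = - (\<Sum>i\<in>{0<..n}. fps_nth x i * fps_nth (inverse x) (n - i))"
        by (simp add: fps_mult_nth sum.head eq_neg_iff_add_eq_0)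
      hence "nrm (fps_nth (inverse x) n)
          = nrm (\<Sum>i\<in>{0<..n}. fps_nth x i * fps_nth (inverse x) (n - i))"
        using assms(3) by (metis nrm_minus nrm_mult mult_1)
      also have "\<dots> \<le> w n"
      proof (rule nrm_sum_leI)
        fix i assume i: "i \<in> {0<..n}"
        have "nrm (fps_nth x i * fps_nth (inverse x) (n - i)) \<le> w i * w (n - i)"
          unfolding nrm_mult using i
          by (intro mult_mono less.IH growthD[OF assms(2)] nrm_nonneg weight_nonneg[OF assms(1)]) auto
        also have "\<dots> \<le> w n" using weight_mult_le[OF assms(1), of i "n - i"] i by simp
        finally show "nrm (fps_nth x i * fps_nth (inverse x) (n - i)) \<le> w n" .
      qed (use assms weight_nonneg in auto)
      finally show ?thesis .
    qed
  qed
qed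

lemma frakS_eq_growth: "frakS nrm = growth (\<lambda>_. 1)"
  by (auto simp: frakS_def growth_def ring_of_integers_def)

text \<open>Partial sums lie in the ring \<open>growth w\<close>, and coefficient bounds survive
  coefficientwise limits.\<close>

lemma adjoin_series_subset_growth:
  assumes "weight w" "T \<in> growth w"
  shows "adjoin_series nrm T \<subseteq> growth w"
proof
  fix x assume "x \<in> adjoin_series nrm T"
  then obtain a where a: "\<And>j. a j \<in> growth (\<lambda>_. 1)" and x: "coeff_sums nrm (\<lambda>j. a j * T ^ j) x"
    unfolding adjoin_series_def frakS_eq_growth by blast
  have aw: "a j \<in> growth w" for j
    using a growth_mono weight_ge_1[OF assms(1)] by blast
  have "a j * T ^ j \<in> growth w" for j
    using assms aw by (intro growth_weight_mult growth_weight_power)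
  hence "(\<Sum>j<N. a j * T ^ j) \<in> growth w" for N
    using assms(1) by (intro growth_sum weight_nonneg)
  hence "nrm (\<Sum>j<N. fps_nth (a j * T ^ j) k) \<le> w k" for N k
    using growthD[of "\<Sum>j<N. a j * T ^ j" w k] by (simp add: fps_sum_nth)
  moreover have "tends (\<lambda>N. \<Sum>j<N. fps_nth (a j * T ^ j) k) (fps_nth x k)" for k
    using x unfolding coeff_sums_def tends_def by (simp add: nrm_diff_commute)
  ultimately show "x \<in> growth w" by (blast intro: growthI tends_nrm_le)
qed

text \<open>Serves to place \<open>E ^ p / p\<close> itself in \<open>S\<close>, from which a lower
  bound for \<open>rho\<close> is read off.\<close>

lemma power_mem_adjoin_series: "T ^ j \<in> adjoin_series nrm T"
proof -
  have "coeff_sums nrm (\<lambda>i. (if i = j then 1 else 0) * T ^ i) (T ^ j)"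
    unfolding coeff_sums_def
  proof
    fix k
    have "(\<Sum>i<N. fps_nth ((if i = j then 1 else 0) * T ^ i) k) = fps_nth (T ^ j) k" if "N > j" for N
    proof -
      have "(\<Sum>i<N. fps_nth ((if i = j then 1 else 0) * T ^ i) k)
          = (\<Sum>i<N. if i = j then fps_nth (T ^ j) k else 0)" by (intro sum.cong) auto
      thus ?thesis using that by simp
    qed
    note eq = this
    have "\<forall>\<^sub>F N in sequentially.
        nrm (fps_nth (T ^ j) k - (\<Sum>i<N. fps_nth ((if i = j then 1 else 0) * T ^ i) k)) = 0"
      using eventually_gt_at_top[of j] by eventually_elim (simp only: eq diff_self nrm_0)
    thus "(\<lambda>N. nrm (fps_nth (T ^ j) k - (\<Sum>i<N. fps_nth ((if i = j then 1 else 0) * T ^ i) k)))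
        \<longlonglongrightarrow> 0"
      by (rule tendsto_eventually)
  qed
  moreover have "(if i = j then 1 else 0) \<in> frakS nrm" for i
    by (simp add: frakS_eq_growth growth_one growth_zero)
  ultimately show ?thesis
    unfolding adjoin_series_def by (intro CollectI exI[of _ "\<lambda>i. if i = j then 1 else 0"]) auto
qed

section \<open>Division by powers of \<open>E\<close>\<close>

lemma E_ser_nth: "fps_nth (E_ser p :: 'a fps) n = (if n = 0 then of_nat p else if n = 1 then 1 else 0)"
  by (simp add: E_ser_def)

lemma E_ser_mult_nth_Suc:
  "fps_nth (E_ser p * q) (Suc n) = fps_nth q n + of_nat p * fps_nth (q :: 'a fps) (Suc n)"
  by (simp add: E_ser_def distrib_right)

lemma E_ser_growth_1: "E_ser p \<in> growth (\<lambda>_. 1)"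
  using p_ge_2 by (intro growthI) (simp add: E_ser_nth nrm_p)

lemma of_nat_p_nonzero: "(of_nat p :: 'a) \<noteq> 0"
  using p_ge_2 by simp

text \<open>Division by the linear polynomial \<open>u + p\<close> with control of sizes. The
  condition \<open>null\<close> makes the evaluation at \<open>- p\<close> converge; by
  \<open>ratio\<close> the factor \<open>1 / p\<close> gained per degree compensates the growth of
  \<open>w\<close>, so remainder and quotient obey the original bounds.\<close>

lemma E_ser_division:
  assumes x: "x \<in> growth w"
    and ratio: "\<And>n. w (Suc n) \<le> real p * w n"
    and null: "(\<lambda>n. w n / real p ^ n) \<longlonglongrightarrow> 0"
  shows "\<exists>r q. x = fps_const r + E_ser p * q \<and> nrm r \<le> w 0 \<and> q \<in> growth (\<lambda>n. w (Suc n))"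
proof -
  \<comment> \<open>Horner's scheme at the root \<open>u = - p\<close> of \<open>E\<close>: \<open>t n\<close> tends to the value at \<open>- p\<close> of the \<open>n\<close>-fold shift of \<open>x\<close>.\<close>
  define t where "t n M = (\<Sum>j<M. fps_nth x (n + j) * (- of_nat p) ^ j)" for n M
  have p0: "real p > 0" using p_ge_2 by simp
  have w_le: "w (n + j) \<le> real p ^ j * w n" for n j
  proof (induction j)
    case (Suc j)
    have "w (n + Suc j) \<le> real p * w (n + j)" using ratio[of "n + j"] by simp
    also have "\<dots> \<le> real p * (real p ^ j * w n)" using Suc p0 by (intro mult_left_mono) auto
    finally show ?case by simp
  qed simp
  have term_le: "nrm (fps_nth x (n + j) * (- of_nat p) ^ j) \<le> w (n + j) / real p ^ j" for n j
    using growthD[OF x, of "n + j"] p0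
    by (simp add: nrm_mult nrm_power nrm_p power_one_over divide_right_mono flip: divide_inverse)
  have "\<exists>y. tends (t n) y" for n
  proof (rule tends_of_null_differences, rule tendsto_sandwich)
    show "\<forall>\<^sub>F M in sequentially. 0 \<le> nrm (t n (Suc M) - t n M)" by (simp add: nrm_nonneg)
    show "\<forall>\<^sub>F M in sequentially. nrm (t n (Suc M) - t n M) \<le> real p ^ n * (w (M + n) / real p ^ (M + n))"
    proof (intro always_eventually allI)
      fix M
      have "nrm (t n (Suc M) - t n M) \<le> w (n + M) / real p ^ M"
        using term_le[of n M] by (simp add: t_def)
      also have "\<dots> = real p ^ n * (w (M + n) / real p ^ (M + n))"
        using p0 by (simp add: power_add field_simps)
      finally show "nrm (t n (Suc M) - t n M) \<le> real p ^ n * (w (M + n) / real p ^ (M + n))" .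
    qed
    show "(\<lambda>M. real p ^ n * (w (M + n) / real p ^ (M + n))) \<longlonglongrightarrow> 0"
      by (rule tendsto_mult_right_zero[OF LIMSEQ_ignore_initial_segment[OF null]])
  qed simp
  then obtain y where y: "\<And>n. tends (t n) (y n)" by metis
  have y_le: "nrm (y n) \<le> w n" for n
  proof (rule tends_nrm_le[OF y])
    fix M
    have "nrm (fps_nth x (n + j) * (- of_nat p) ^ j) \<le> w n" for j
    proof -
      have "w (n + j) / real p ^ j \<le> w n" using w_le[of n j] p0 by (simp add: field_simps)
      thus ?thesis using term_le[of n j] by linarith
    qed
    thus "nrm (t n M) \<le> w n" unfolding t_def using growth_weight_nonneg[OF x] by (intro nrm_sum_leI)
  qed
  \<comment> \<open>This recursion is the coefficient comparison for \<open>x = y 0 + E * q\<close>,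
    with \<open>q\<close> built from the later values of \<open>y\<close>.\<close>
  have y_rec: "y n = fps_nth x n - of_nat p * y (Suc n)" for n
  proof (rule tends_unique)
    show "tends (\<lambda>M. t n (Suc M)) (y n)"
      using y[of n] unfolding tends_def by (rule LIMSEQ_Suc)
    have "t n (Suc M) = fps_nth x n - of_nat p * t (Suc n) M" for M
      unfolding t_def sum.lessThan_Suc_shift by (simp add: sum_distrib_left sum_negf ac_simps)
    thus "tends (\<lambda>M. t n (Suc M)) (fps_nth x n - of_nat p * y (Suc n))"
      by (auto intro!: tends_diff tends_const tends_cmult y)
  qed
  have "x = fps_const (y 0) + E_ser p * Abs_fps (\<lambda>n. y (Suc n))"
  proof (rule fps_ext)
    fix n show "fps_nth x n = fps_nth (fps_const (y 0) + E_ser p * Abs_fps (\<lambda>n. y (Suc n))) n"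
    proof (cases n)
      case 0 thus ?thesis using y_rec[of 0] by (simp add: E_ser_nth)
    next
      case (Suc m)
      show ?thesis unfolding Suc fps_add_nth E_ser_mult_nth_Suc using y_rec[of "Suc m"] by simp
    qed
  qed
  moreover have "Abs_fps (\<lambda>n. y (Suc n)) \<in> growth (\<lambda>n. w (Suc n))"
    using y_le by (intro growthI) simp
  ultimately show ?thesis using y_le by blast
qed

text \<open>Iterated division by \<open>E\<close>: the remainder of step \<open>j\<close> is bounded
  by \<open>w j\<close>, and the integral factors \<open>E ^ j\<close> keep that bound when the
  remainders are collected in \<open>l\<close>. Hence only degrees below \<open>N\<close> enter the
  bound \<open>b\<close>.\<close>

lemma E_ser_power_division:
  assumes x: "x \<in> growth w"
    and ratio: "\<And>n. w (Suc n) \<le> real p * w n"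
    and null: "(\<lambda>n. w n / real p ^ n) \<longlonglongrightarrow> 0"
    and bound: "\<And>j. j < N \<Longrightarrow> w j \<le> b" and b: "0 \<le> b"
  shows "\<exists>l q. x = l + E_ser p ^ N * q \<and> l \<in> growth (\<lambda>_. b) \<and> q \<in> growth (\<lambda>n. w (n + N))"
  using bound
proof (induction N)
  case 0
  show ?case using x b by (intro exI[of _ 0] exI[of _ x]) (auto simp: growth_zero)
next
  case (Suc N)
  then obtain l q where lq: "x = l + E_ser p ^ N * q" "l \<in> growth (\<lambda>_. b)" "q \<in> growth (\<lambda>n. w (n + N))"
    by auto
  have "(\<lambda>n. real p ^ N * (w (n + N) / real p ^ (n + N))) \<longlonglongrightarrow> 0"
    by (rule tendsto_mult_right_zero[OF LIMSEQ_ignore_initial_segment[OF null]])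
  moreover have "real p ^ N * (w (n + N) / real p ^ (n + N)) = w (n + N) / real p ^ n" for n
    using p_ge_2 by (simp add: power_add field_simps)
  ultimately have "(\<lambda>n. w (n + N) / real p ^ n) \<longlonglongrightarrow> 0" by simp
  then obtain r q' where rq: "q = fps_const r + E_ser p * q'" "nrm r \<le> w N"
      "q' \<in> growth (\<lambda>n. w (Suc n + N))"
    using E_ser_division[OF lq(3)] ratio by auto
  have "E_ser p ^ N * fps_const r \<in> growth (\<lambda>_. b)"
  proof (rule growth_mult)
    show "E_ser p ^ N \<in> growth (\<lambda>_. 1)" using E_ser_growth_1 weight_const_1 growth_weight_power by blast
    show "fps_const r \<in> growth (\<lambda>_. b)" using rq(2) Suc.prems[of N] b by (intro growth_const) auto
  qed simp
  hence "l + E_ser p ^ N * fps_const r \<in> growth (\<lambda>_. b)" using lq(2) growth_add by blast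
  moreover have "x = (l + E_ser p ^ N * fps_const r) + E_ser p ^ Suc N * q'"
    using lq(1) rq(1) by (simp add: algebra_simps)
  ultimately show ?case using rq(3) by auto
qed

end

section \<open>The ring \<open>R\<close> as a growth condition\<close>

locale uniformized_ext = finite_ext_Qp +
  fixes \<pi> :: 'a
  assumes uniformizer_pi: "uniformizer nrm \<pi>"
begin

lemma nrm_less_1_iff: "nrm x < 1 \<longleftrightarrow> (\<exists>y. nrm y \<le> 1 \<and> x = \<pi> * y)"
  using uniformizer_pi unfolding uniformizer_def ring_of_integers_def by blast

lemma nrm_pi_less_1: "nrm \<pi> < 1"
  unfolding nrm_less_1_iff by (intro exI[of _ 1]) simp

lemma nrm_p_le_nrm_pi: "1 / real p \<le> nrm \<pi>"
proof -
  have "nrm (of_nat p) < 1" using p_ge_2 by (simp add: nrm_p)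
  then obtain y where "nrm y \<le> 1" "of_nat p = \<pi> * y" unfolding nrm_less_1_iff by blast
  hence "nrm (of_nat p) \<le> nrm \<pi>" using nrm_nonneg by (simp add: nrm_mult mult_left_le)
  thus ?thesis by (simp add: nrm_p)
qed

lemma pi_nonzero: "\<pi> \<noteq> 0"
  using nrm_p_le_nrm_pi p_ge_2 by auto

text \<open>The number \<open>1 / rho\<close> is the norm of \<open>p / \<pi>\<close>; the bound
  \<open>rho ^ n\<close> describes series of Gauss norm at most 1 on the disc of that
  radius.\<close>

definition rho :: real where "rho = real p * nrm \<pi>"

lemma rho_ge_1: "1 \<le> rho"
  using nrm_p_le_nrm_pi p_ge_2 unfolding rho_def by (simp add: field_simps)

lemma rho_le_p: "rho \<le> real p"
  using nrm_pi_less_1 unfolding rho_def by (simp add: mult_left_le)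

lemma weight_rho: "weight (\<lambda>n. rho ^ n)"
  using weight_power rho_ge_1 .

lemma rho_power_null: "(\<lambda>n. rho ^ n / real p ^ n) \<longlonglongrightarrow> 0"
proof -
  have "rho ^ n / real p ^ n = nrm \<pi> ^ n" for n
    using p_ge_2 by (simp add: rho_def power_mult_distrib)
  thus ?thesis using nrm_pi_less_1 nrm_nonneg[of \<pi>] by (simp add: LIMSEQ_realpow_zero)
qed

lemma R_ring_generator_growth:
  "fps_const (\<pi> / of_nat p) * E_ser p \<in> growth (\<lambda>n. nrm \<pi> * real p ^ n)"
  using p_ge_2 by (intro growthI) (auto simp: E_ser_nth nrm_mult nrm_divide nrm_p of_nat_p_nonzero nrm_nonneg)

text \<open>One inclusion holds because the generator satisfies the bound. For the other, repeated
  division by \<open>E\<close> expands \<open>x\<close> in powers of the generator with constant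
  coefficients.\<close>

lemma R_ring_eq_growth: "R_ring p nrm \<pi> = growth (\<lambda>n. rho ^ n)"
proof
  let ?T = "fps_const (\<pi> / of_nat p) * E_ser p"
  have "?T \<in> growth (\<lambda>n. rho ^ n)"
    using nrm_pi_less_1 rho_ge_1 of_nat_p_nonzero
    by (intro growthI) (auto simp: E_ser_nth nrm_mult nrm_divide nrm_p rho_def mult.commute)
  thus "R_ring p nrm \<pi> \<subseteq> growth (\<lambda>n. rho ^ n)"
    unfolding R_ring_def using adjoin_series_subset_growth weight_rho by blast
  show "growth (\<lambda>n. rho ^ n) \<subseteq> R_ring p nrm \<pi>"
  proof
    fix x assume x: "x \<in> growth (\<lambda>n. rho ^ n)"
    \<comment> \<open>Since \<open>rho\<close> is the norm of \<open>\<pi> / p\<close>, dividing the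
      quotient by this constant, which moves into the generator, improves its bound from
      \<open>rho ^ Suc n\<close> to \<open>rho ^ n\<close>.\<close>
    have "\<exists>r q. y = fps_const r + ?T * q \<and> nrm r \<le> 1 \<and> q \<in> growth (\<lambda>n. rho ^ n)"
      if y: "y \<in> growth (\<lambda>n. rho ^ n)" for y
    proof -
      obtain r q where rq: "y = fps_const r + E_ser p * q" "nrm r \<le> rho ^ 0" "q \<in> growth (\<lambda>n. rho ^ Suc n)"
        using E_ser_division[OF y _ rho_power_null] rho_le_p rho_ge_1 by (auto simp: mult_right_mono)
      have "fps_const (of_nat p / \<pi>) * q \<in> growth (\<lambda>n. rho ^ n)"
      proof (rule growthI)
        fix n
        have "nrm (fps_nth q n) \<le> rho * rho ^ n" using growthD[OF rq(3), of n] by simp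
        moreover have "nrm (of_nat p / \<pi>) = 1 / rho"
          by (simp add: nrm_divide nrm_p rho_def)
        ultimately show "nrm (fps_nth (fps_const (of_nat p / \<pi>) * q) n) \<le> rho ^ n"
          using rho_ge_1 unfolding fps_mult_left_const_nth nrm_mult
          by (simp add: divide_le_eq mult.commute del: nrm_divide)
      qed
      moreover have "?T * (fps_const (of_nat p / \<pi>) * q)
          = (fps_const (\<pi> / of_nat p) * fps_const (of_nat p / \<pi>)) * (E_ser p * q)"
        by (simp only: ac_simps)
      hence "y = fps_const r + ?T * (fps_const (of_nat p / \<pi>) * q)"
        using rq(1) pi_nonzero of_nat_p_nonzero by simp
      ultimately show ?thesis using rq(2) by (metis power_0)
    qed
    then obtain r q where rq: "\<And>y. y \<in> growth (\<lambda>n. rho ^ n) \<Longrightarrow>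
        y = fps_const (r y) + ?T * q y \<and> nrm (r y) \<le> 1 \<and> q y \<in> growth (\<lambda>n. rho ^ n)" by metis
    define z where "z j = (q ^^ j) x" for j
    have z: "z j \<in> growth (\<lambda>n. rho ^ n)" for j
      by (induction j) (use x rq in \<open>auto simp: z_def\<close>)
    define a where "a j = fps_const (r (z j))" for j
    have expand: "x = (\<Sum>j<N. a j * ?T ^ j) + ?T ^ N * z N" for N
    proof (induction N)
      case 0 show ?case by (simp add: z_def)
    next
      case (Suc N)
      have "z N = a N + ?T * z (Suc N)" using rq[OF z[of N]] by (simp add: a_def z_def)
      hence "?T ^ N * z N = a N * ?T ^ N + ?T ^ Suc N * z (Suc N)"
        by (simp only: distrib_left power_Suc2 mult.assoc) (simp only: mult.commute)
      thus ?case using Suc by (simp only: sum.lessThan_Suc add.assoc)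
    qed
    have a_S: "a j \<in> frakS nrm" for j
      using rq[OF z[of j]] by (simp add: a_def frakS_eq_growth growth_const)
    have "coeff_sums nrm (\<lambda>j. a j * ?T ^ j) x"
      unfolding coeff_sums_def
    proof
      fix k
      \<comment> \<open>In the weight \<open>rho ^ n\<close> the bound for powers of the generator
        does not shrink. In the larger weight \<open>p ^ n\<close> each factor gains
        \<open>nrm \<pi>\<close>, so the remainder vanishes coefficientwise.\<close>
      have le: "nrm (fps_nth x k - (\<Sum>j<N. fps_nth (a j * ?T ^ j) k)) \<le> nrm \<pi> ^ N * real p ^ k" for N
      proof -
        have "?T ^ N \<in> growth (\<lambda>n. nrm \<pi> ^ N * real p ^ n)"
          using R_ring_generator_growth nrm_nonneg p_ge_2
          by (intro growth_weight_scaled_power weight_power) auto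
        moreover have "z N \<in> growth (\<lambda>n. 1 * real p ^ n)"
          using rho_le_p rho_ge_1 by (intro growth_mono[OF z]) (auto intro: power_mono)
        ultimately have "?T ^ N * z N \<in> growth (\<lambda>n. nrm \<pi> ^ N * 1 * real p ^ n)"
          using nrm_nonneg p_ge_2 by (intro growth_weight_scaled_mult weight_power) auto
        moreover have "fps_nth (?T ^ N * z N) k = fps_nth x k - (\<Sum>j<N. fps_nth (a j * ?T ^ j) k)"
          using arg_cong[OF expand[of N], of "\<lambda>y. fps_nth y k"] by (simp add: fps_sum_nth)
        ultimately show ?thesis using growthD[of _ _ k] by (metis mult_1_right)
      qed
      have "(\<lambda>N. nrm \<pi> ^ N * real p ^ k) \<longlonglongrightarrow> 0"
        using nrm_pi_less_1 nrm_nonneg by (intro tendsto_mult_left_zero LIMSEQ_realpow_zero)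
      thus "(\<lambda>N. nrm (fps_nth x k - (\<Sum>j<N. fps_nth (a j * ?T ^ j) k))) \<longlonglongrightarrow> 0"
        by (rule Lim_null_comparison[rotated]) (use le nrm_nonneg in simp)
    qed
    thus "x \<in> R_ring p nrm \<pi>"
      unfolding R_ring_def adjoin_series_def using a_S by (intro CollectI exI[of _ a]) auto
  qed
qed

text \<open>The integral quotient \<open>q\<close> of \<open>E * h\<close> differs from
  \<open>h\<close> by a constant multiple of \<open>1 / E\<close>, whose coefficients grow like
  \<open>p ^ n\<close>. This is faster than \<open>rho ^ n\<close>, so the difference
  vanishes.\<close>

lemma E_ser_saturated:
  assumes h: "h \<in> growth (\<lambda>n. rho ^ n)" and Eh: "E_ser p * h \<in> growth (\<lambda>_. 1)"
  shows "h \<in> growth (\<lambda>_. 1)"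
proof -
  have "(\<lambda>n. (1 / real p) ^ n) \<longlonglongrightarrow> 0" using p_ge_2 by (intro LIMSEQ_realpow_zero) auto
  hence "(\<lambda>n. 1 / real p ^ n) \<longlonglongrightarrow> 0" by (simp add: power_one_over)
  then obtain r q where rq: "E_ser p * h = fps_const r + E_ser p * q" "q \<in> growth (\<lambda>_. 1)"
    using E_ser_division[OF Eh] p_ge_2 by auto
  define d where "d = h - q"
  have Ed: "E_ser p * d = fps_const r" using rq(1) by (simp add: d_def algebra_simps)
  have rec: "fps_nth d (Suc n) = - fps_nth d n / of_nat p" for n
    using arg_cong[OF Ed, of "\<lambda>y. fps_nth y (Suc n)"] of_nat_p_nonzero
    unfolding E_ser_mult_nth_Suc by (simp add: field_simps eq_neg_iff_add_eq_0)
  have d: "nrm (fps_nth d n) = real p ^ n * nrm (fps_nth d 0)" for n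
    by (induction n) (simp_all add: rec nrm_divide nrm_p)
  have "q \<in> growth (\<lambda>n. rho ^ n)" using rq(2) growth_mono weight_ge_1[OF weight_rho] by blast
  hence "d \<in> growth (\<lambda>n. rho ^ n)" unfolding d_def using h growth_diff by blast
  hence "nrm (fps_nth d 0) \<le> rho ^ n / real p ^ n" for n
    using growthD[of d _ n] d[of n] p_ge_2 by (simp add: field_simps)
  hence "nrm (fps_nth d 0) \<le> 0" using rho_power_null by (intro LIMSEQ_le_const) auto
  hence "fps_nth d 0 = 0" using nrm_nonneg nrm_eq_0_iff by (meson order_antisym)
  hence "fps_nth d n = 0" for n using d[of n] nrm_eq_0_iff by simp
  hence "d = 0" by (intro fps_ext) simp
  thus ?thesis using rq(2) by (simp add: d_def)
qed

lemma E_ser_power_saturated: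
  assumes "h \<in> growth (\<lambda>n. rho ^ n)" "E_ser p ^ k * h \<in> growth (\<lambda>_. 1)"
  shows "h \<in> growth (\<lambda>_. 1)"
  using assms
proof (induction k)
  case (Suc k)
  have "E_ser p ^ k \<in> growth (\<lambda>n. rho ^ n)"
    using growth_mono[OF growth_weight_power[OF weight_const_1 E_ser_growth_1]] weight_ge_1[OF weight_rho]
    by blast
  hence "E_ser p ^ k * h \<in> growth (\<lambda>n. rho ^ n)"
    using Suc.prems(1) growth_weight_mult[OF weight_rho] by blast
  hence "E_ser p ^ k * h \<in> growth (\<lambda>_. 1)"
    using E_ser_saturated Suc.prems(2) by (simp add: mult.assoc)
  thus ?case using Suc by blast
qed simp

end

section \<open>Matrices and the Frobenius\<close>

lemma phi_nth: "p > 0 \<Longrightarrow> fps_nth (phi p x) n = (if p dvd n then fps_nth x (n div p) else 0)"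
  by (simp add: phi_def fps_nth_compose_X_power)

lemma phi_mult: "p > 0 \<Longrightarrow> phi p (x * y) = phi p x * phi p y"
  by (simp add: phi_def fps_compose_mult_distrib)

lemma phi_power: "p > 0 \<Longrightarrow> phi p (x ^ n) = phi p x ^ n"
  by (simp add: phi_def fps_compose_power)

lemma phi_add: "phi p (x + y) = phi p x + phi p y"
  by (simp add: phi_def fps_compose_add_distrib)

lemma phi_diff: "phi p (x - y) = phi p x - phi p y"
  by (simp add: phi_def fps_compose_sub_distrib)

lemma phi_minus: "phi p (- x) = - phi p x"
  by (simp add: phi_def fps_compose_uminus)

lemma phi_sum: "phi p (\<Sum>i\<in>I. x i) = (\<Sum>i\<in>I. phi p (x i))"
  by (simp add: phi_def fps_compose_sum_distrib)

lemma phi_const [simp]: "phi p (fps_const a) = fps_const a"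
  by (simp add: phi_def)

lemma phi_0 [simp]: "phi p 0 = 0" and phi_1 [simp]: "phi p 1 = 1"
  by (simp_all add: phi_def)

lemma phi_mat_mult: "p > 0 \<Longrightarrow> phi_mat p (X ** Y) = phi_mat p X ** phi_mat p Y"
  by (simp add: phi_mat_def matrix_matrix_mult_def vec_eq_iff phi_sum phi_mult)

lemma phi_mat_add: "phi_mat p (X + Y) = phi_mat p X + phi_mat p Y"
  by (simp add: phi_mat_def vec_eq_iff phi_add)

lemma phi_mat_1 [simp]: "phi_mat p (mat 1) = mat 1"
  by (simp add: phi_mat_def mat_def vec_eq_iff)

lemma phi_det_2: "p > 0 \<Longrightarrow> phi p (det (X :: 'a::field_char_0 fps ^ 2 ^ 2)) = det (phi_mat p X)"
  by (simp add: det_2 phi_mat_def phi_diff phi_mult)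

lemma matrix_add_rdistrib: "(A + B) ** (C :: 'a::semiring_1 ^ 'n ^ 'm) = A ** C + B ** C"
  by (simp add: matrix_matrix_mult_def vec_eq_iff distrib_right sum.distrib)

lemma matrix_diff_ldistrib: "(A :: 'a::ring_1 ^ 'n ^ 'm) ** (B - C) = A ** B - A ** C"
  by (simp add: matrix_matrix_mult_def vec_eq_iff right_diff_distrib sum_subtractf)

lemma matrix_uminus_left: "(- A) ** (C :: 'a::ring_1 ^ 'n ^ 'm) = - (A ** C)"
  by (simp add: matrix_matrix_mult_def vec_eq_iff sum_negf)

lemma mat_scalar_mult_nth: "(mat (a :: 'a::comm_ring_1) ** X) $ i $ j = a * X $ i $ j"
proof -
  have "(mat a ** X) $ i $ j = (\<Sum>k\<in>UNIV. if k = i then a * X $ i $ j else 0)"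
    unfolding matrix_matrix_mult_def mat_def vec_lambda_beta by (intro sum.cong) auto
  thus ?thesis by simp
qed

lemma mat_scalar_commute: "X ** mat (a :: 'a::comm_ring_1) = mat a ** X"
proof -
  have "(X ** mat a) $ i $ j = (\<Sum>k\<in>UNIV. if k = j then a * X $ i $ j else 0)" for i j
    unfolding matrix_matrix_mult_def mat_def vec_lambda_beta by (intro sum.cong) auto
  thus ?thesis by (simp add: vec_eq_iff mat_scalar_mult_nth)
qed

lemma mat_scalar_mult: "mat (a :: 'a::comm_ring_1) ** mat b = mat (a * b)"
  by (simp add: vec_eq_iff mat_scalar_mult_nth) (simp add: mat_def)

lemma matrix_left_inverse_unique:
  fixes M :: "'a::comm_ring_1 ^ 'n ^ 'n"
  assumes "N ** M = mat 1" "M ** N' = mat 1"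
  shows "N = N'"
proof -
  have "N ** (M ** N') = (N ** M) ** N'" by (rule matrix_mul_assoc)
  thus ?thesis using assms by simp
qed

text \<open>\<open>matrix_inv\<close> is defined by choice; a two-sided inverse pins the choice
  down.\<close>

lemma matrix_inv_eqI:
  fixes M :: "'a::comm_ring_1 ^ 'n ^ 'n"
  assumes "M ** N = mat 1" "N ** M = mat 1"
  shows "matrix_inv M = N"
proof -
  have "M ** matrix_inv M = mat 1 \<and> matrix_inv M ** M = mat 1"
    unfolding matrix_inv_def by (rule someI[of _ N]) (use assms in blast)
  thus ?thesis using matrix_left_inverse_unique assms(1) by blast
qed

definition adj2 :: "'a::comm_ring_1 ^ 2 ^ 2 \<Rightarrow> 'a ^ 2 ^ 2" where
  "adj2 M = vector [vector [M $ 2 $ 2, - M $ 1 $ 2], vector [- M $ 2 $ 1, M $ 1 $ 1]]"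

lemma adj2_mult: "M ** adj2 M = mat (det M)" "adj2 M ** M = mat (det M)"
  by (simp_all add: vec_eq_iff forall_2 adj2_def matrix_matrix_mult_def sum_2 mat_def det_2 ac_simps)

lemma MatI: "(\<And>i j. M $ i $ j \<in> T) \<Longrightarrow> M \<in> Mat T"
  by (simp add: Mat_def)

lemma MatD: "M \<in> Mat T \<Longrightarrow> M $ i $ j \<in> T"
  by (simp add: Mat_def)

context finite_ext_Qp
begin

section \<open>Matrices with entries of bounded growth\<close>

lemma p_pos: "p > 0"
  using p_ge_2 by simp

lemma Mat_growth_mono: "M \<in> Mat (growth w) \<Longrightarrow> (\<And>n. w n \<le> w' n) \<Longrightarrow> M \<in> Mat (growth w')"
  by (intro MatI) (rule growth_mono[OF MatD])

lemma Mat_growth_add: "M \<in> Mat (growth w) \<Longrightarrow> N \<in> Mat (growth w) \<Longrightarrow> M + N \<in> Mat (growth w)"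
  unfolding Mat_def by (simp add: growth_add)

lemma Mat_growth_minus: "M \<in> Mat (growth w) \<Longrightarrow> - M \<in> Mat (growth w)"
  unfolding Mat_def by (simp add: growth_minus)

lemma Mat_growth_1: "weight w \<Longrightarrow> mat 1 \<in> Mat (growth w)"
  by (auto intro!: MatI growth_one growth_zero simp: mat_def weight_ge_1 weight_nonneg)

lemma Mat_growth_mult:
  assumes "M \<in> Mat (growth w)" "N \<in> Mat (growth w')" "\<And>a b. w a * w' b \<le> w'' (a + b)"
  shows "M ** N \<in> Mat (growth w'')"
proof (rule MatI)
  fix i j
  have prod: "M $ i $ k * N $ k $ j \<in> growth w''" for k
    using growth_mult MatD assms by blast
  show "(M ** N) $ i $ j \<in> growth w''"
    unfolding matrix_matrix_mult_def using prod growth_weight_nonneg[OF prod[of undefined]]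
    by (auto intro!: growth_sum)
qed

lemma Mat_growth_weight_mult:
  "weight w \<Longrightarrow> M \<in> Mat (growth w) \<Longrightarrow> N \<in> Mat (growth w) \<Longrightarrow> M ** N \<in> Mat (growth w)"
  by (rule Mat_growth_mult[of M w N w]) (auto simp: weight_mult_le)

lemma Mat_growth_scaled_mult:
  assumes "weight w" "M \<in> Mat (growth (\<lambda>n. a * w n))" "N \<in> Mat (growth (\<lambda>n. b * w n))" "0 \<le> a" "0 \<le> b"
  shows "M ** N \<in> Mat (growth (\<lambda>n. a * b * w n))"
proof (rule Mat_growth_mult[OF assms(2,3)])
  fix i j
  have "a * b * (w i * w j) \<le> a * b * w (i + j)"
    using assms by (intro mult_left_mono weight_mult_le) auto
  thus "a * w i * (b * w j) \<le> a * b * w (i + j)" by (simp add: ac_simps)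
qed

lemma Mat_growth_scaled_mult_right:
  assumes "weight w" "M \<in> Mat (growth (\<lambda>n. a * w n))" "N \<in> Mat (growth w)" "0 \<le> a"
  shows "M ** N \<in> Mat (growth (\<lambda>n. a * w n))"
  using Mat_growth_scaled_mult[of w M a N 1] assms by simp

lemma Mat_growth_scaled_mult_left:
  assumes "weight w" "M \<in> Mat (growth w)" "N \<in> Mat (growth (\<lambda>n. a * w n))" "0 \<le> a"
  shows "M ** N \<in> Mat (growth (\<lambda>n. a * w n))"
  using Mat_growth_scaled_mult[of w M 1 N a] assms by simp

lemma Mat_growth_mat: "x \<in> growth w \<Longrightarrow> mat x \<in> Mat (growth w)"
  using growth_weight_nonneg by (intro MatI) (auto simp: mat_def intro!: growth_zero)

lemma det_growth: "weight w \<Longrightarrow> M \<in> Mat (growth w) \<Longrightarrow> det (M :: 'a fps ^ 2 ^ 2) \<in> growth w"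
  unfolding det_2 by (intro growth_diff growth_weight_mult MatD)

lemma adj2_growth: "M \<in> Mat (growth w) \<Longrightarrow> adj2 M \<in> Mat (growth w)"
  by (simp add: Mat_def forall_2 adj2_def growth_minus)

text \<open>The adjugate is divided by the unit part \<open>g\<close> of the determinant. With
  \<open>e = E ^ k\<close> this supplies the height condition, with \<open>e = 1\<close> it supplies
  inverses.\<close>

lemma complementary_matrix:
  fixes M :: "'a fps ^ 2 ^ 2"
  assumes "weight w" "M \<in> Mat (growth w)" "det M = e * g" "g \<in> growth w" "nrm (fps_nth g 0) = 1"
  shows "\<exists>B\<in>Mat (growth w). M ** B = mat e \<and> B ** M = mat e"
proof (intro bexI conjI)
  let ?B = "mat (inverse g) ** adj2 M"
  show "?B \<in> Mat (growth w)"
    using assms by (intro Mat_growth_weight_mult adj2_growth Mat_growth_mat growth_weight_inverse)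
  have "fps_nth g 0 \<noteq> 0" using assms(5) by auto
  hence eq: "inverse g * det M = e"
    unfolding assms(3) using inverse_mult_eq_1[of g] by (simp add: mult.left_commute)
  show "?B ** M = mat e"
    by (simp add: matrix_mul_assoc[symmetric] adj2_mult mat_scalar_mult eq)
  have "M ** ?B = mat (inverse g) ** (M ** adj2 M)"
    unfolding matrix_mul_assoc mat_scalar_commute[of M] ..
  thus "M ** ?B = mat e" by (simp add: adj2_mult mat_scalar_mult eq)
qed

text \<open>In the expanded 2 by 2 determinant everything except the summand 1 has a constant
  coefficient of norm at most \<open>w 0\<close>.\<close>

lemma det_perturbation_unit:
  fixes Z :: "'a fps ^ 2 ^ 2"
  assumes "Z \<in> Mat (growth w)" "w 0 < 1"
  shows "nrm (fps_nth (det (mat 1 + Z)) 0) = 1"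
proof -
  let ?z = "\<lambda>i j. fps_nth (Z $ i $ j) 0"
  have z: "nrm (?z i j) \<le> w 0" for i j using assms(1) MatD growthD by blast
  have zz: "nrm (?z i j * ?z i' j') \<le> w 0" for i j i' j'
  proof -
    have "nrm (?z i j) * nrm (?z i' j') \<le> nrm (?z i j)"
      using z[of i' j'] assms(2) nrm_nonneg by (intro mult_left_le) auto
    thus ?thesis unfolding nrm_mult using z[of i j] by linarith
  qed
  have eq: "fps_nth (det (mat 1 + Z)) 0 = 1 + (?z 1 1 + ?z 2 2 + (?z 1 1 * ?z 2 2 - ?z 1 2 * ?z 2 1))"
    by (simp add: det_2 mat_def algebra_simps)
  have "nrm (?z 1 1 + ?z 2 2 + (?z 1 1 * ?z 2 2 - ?z 1 2 * ?z 2 1)) \<le> w 0"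
    by (intro nrm_add_leI nrm_diff_leI z zz)
  hence "nrm (1 - fps_nth (det (mat 1 + Z)) 0) < nrm 1"
    unfolding eq nrm_diff_commute[of 1] using assms(2) by simp
  thus ?thesis using nrm_eq_of_close nrm_1 by metis
qed

lemma nrm_const_coeff_mult: "nrm (fps_nth (x * y) 0) = nrm (fps_nth x 0) * nrm (fps_nth y 0)"
  by (simp add: nrm_mult)

text \<open>Both constant coefficients have norm at most \<open>w 0 = 1\<close>, and their product
  has norm 1.\<close>

lemma det_const_coeff_unit:
  fixes M N :: "'a fps ^ 2 ^ 2"
  assumes "weight w" "w 0 = 1" "M \<in> Mat (growth w)" "N \<in> Mat (growth w)" "M ** N = mat 1"
  shows "nrm (fps_nth (det M) 0) = 1" "nrm (fps_nth (det N) 0) = 1"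
proof -
  have "det M * det N = 1" using assms(5) by (metis det_mul det_I)
  hence "nrm (fps_nth (det M) 0) * nrm (fps_nth (det N) 0) = 1"
    unfolding nrm_const_coeff_mult[symmetric] by simp
  moreover have "nrm (fps_nth (det M) 0) \<le> 1" "nrm (fps_nth (det N) 0) \<le> 1"
    using growthD[OF det_growth[OF assms(1)], of _ 0] assms(2-4) by auto
  moreover have "x = 1 \<and> y = 1" if "x * y = 1" "0 \<le> x" "x \<le> 1" "0 \<le> y" "y \<le> 1" for x y :: real
    using that mult_left_le[of y x] mult_left_le[of x y] by (simp add: mult.commute)
  ultimately show "nrm (fps_nth (det M) 0) = 1" "nrm (fps_nth (det N) 0) = 1"
    using nrm_nonneg by blast+
qed

section \<open>The Frobenius and the ring \<open>S\<close> in terms of coefficient bounds\<close>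

lemma phi_growth:
  assumes "x \<in> growth w" "mono w"
  shows "phi p x \<in> growth w"
proof (rule growthI)
  fix n
  have "nrm (fps_nth x (n div p)) \<le> w n"
    using growthD[OF assms(1), of "n div p"] monoD[OF assms(2), of "n div p" n] by simp
  thus "nrm (fps_nth (phi p x) n) \<le> w n"
    using growth_weight_nonneg[OF assms(1)] by (simp add: phi_nth p_pos)
qed

lemma phi_mat_growth: "M \<in> Mat (growth w) \<Longrightarrow> mono w \<Longrightarrow> phi_mat p M \<in> Mat (growth w)"
  unfolding Mat_def phi_mat_def by (simp add: phi_growth)

text \<open>The element \<open>(E ^ p / p) ^ j\<close> has degree \<open>j * p\<close> and a leading
  coefficient of norm \<open>p ^ j\<close>, the fastest growth that \<open>S\<close> permits in that
  degree.\<close>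

definition wS :: "nat \<Rightarrow> real" where "wS n = real p ^ (n div p)"

lemma wS_0 [simp]: "wS 0 = 1"
  by (simp add: wS_def)

lemma mono_wS: "mono wS"
  using p_ge_2 unfolding wS_def by (intro monoI power_increasing div_le_mono) auto

lemma mono_scaled_wS: "0 \<le> a \<Longrightarrow> mono (\<lambda>n. a * wS n)"
  using mono_wS by (auto simp: mono_def intro: mult_left_mono)

lemma div_add_div_le: "a div p + b div p \<le> (a + b) div p"
  by (subst div_add1_eq) simp

lemma weight_wS: "weight wS"
  unfolding weight_def wS_def power_add[symmetric]
  using p_ge_2 by (intro conjI allI power_increasing div_add_div_le one_le_power) auto

lemma wS_add_multiple: "wS (n + c * p) = real p ^ c * wS n"
  using p_pos by (simp add: wS_def power_add mult.commute)

lemma wS_Suc_le: "wS (Suc n) \<le> real p * wS n"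
proof -
  have "Suc n div p \<le> Suc (n div p)" by (simp add: div_Suc)
  hence "real p ^ (Suc n div p) \<le> real p ^ Suc (n div p)"
    using p_ge_2 by (intro power_increasing) auto
  thus ?thesis by (simp add: wS_def)
qed

text \<open>As \<open>n div p\<close> is at most half of \<open>n\<close>, the weight is bounded by
  a power of the square root of \<open>p\<close>.\<close>

lemma wS_null: "(\<lambda>n. wS n / real p ^ n) \<longlonglongrightarrow> 0"
proof (rule tendsto_sandwich[OF _ _ tendsto_const])
  have le: "wS n \<le> sqrt (real p) ^ n" for n
  proof (rule power2_le_imp_le)
    have "n div p * 2 \<le> n div p * p" using p_ge_2 by (intro mult_left_mono) auto
    also have "\<dots> \<le> n" by simp
    finally have "real p ^ (n div p * 2) \<le> real p ^ n"
      using p_ge_2 by (intro power_increasing) auto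
    also have "real p ^ n = (sqrt (real p) ^ n)\<^sup>2"
      by (metis of_nat_0_le_iff power_mult mult.commute real_sqrt_pow2)
    finally show "(wS n)\<^sup>2 \<le> (sqrt (real p) ^ n)\<^sup>2" by (simp add: wS_def power_mult)
  qed simp
  have eq: "sqrt (real p) ^ n / real p ^ n = (1 / sqrt (real p)) ^ n" for n
  proof -
    have "sqrt (real p) / real p = 1 / sqrt (real p)"
      using p_pos by (simp add: field_simps)
    thus ?thesis by (metis power_divide)
  qed
  show "\<forall>\<^sub>F n in sequentially. wS n / real p ^ n \<le> (1 / sqrt (real p)) ^ n"
    unfolding eq[symmetric] using le by (intro always_eventually allI divide_right_mono) auto
  have "1 < sqrt (real p)" using p_ge_2 by simp
  thus "(\<lambda>n. (1 / sqrt (real p)) ^ n) \<longlonglongrightarrow> 0"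
    by (intro LIMSEQ_realpow_zero) auto
qed (use weight_nonneg[OF weight_wS] in auto)

lemma frakS_le_S: "x \<in> growth (\<lambda>_. 1) \<Longrightarrow> x \<in> growth wS"
  by (erule growth_mono) (simp add: weight_ge_1[OF weight_wS])

lemma E_ser_power_p_growth: "E_ser p ^ p \<in> growth (\<lambda>n. 1 / real p * wS n)"
proof (rule growthI)
  fix n
  show "nrm (fps_nth (E_ser p ^ p) n) \<le> 1 / real p * wS n"
  proof (cases "n < p")
    case True
    \<comment> \<open>Both coefficients of \<open>E\<close> are bounded by \<open>p ^ n / p\<close>,
      so below degree \<open>p\<close> the coefficient of \<open>E ^ p\<close> has norm at most
      \<open>1 / p ^ (p - n)\<close>.\<close>
    have "E_ser p \<in> growth (\<lambda>n. 1 / real p * real p ^ n)"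
      using p_ge_2 by (intro growthI) (auto simp: E_ser_nth nrm_p)
    hence "E_ser p ^ p \<in> growth (\<lambda>n. (1 / real p) ^ p * real p ^ n)"
      using p_ge_2 by (intro growth_weight_scaled_power weight_power) auto
    hence "nrm (fps_nth (E_ser p ^ p) n) \<le> (1 / real p) ^ p * real p ^ n" by (rule growthD)
    also have "\<dots> = (1 / real p) ^ (p - n)"
      using True p_pos by (simp add: power_diff power_one_over field_simps)
    also have "\<dots> \<le> (1 / real p) ^ 1"
      using True p_ge_2 by (intro power_decreasing) auto
    finally show ?thesis using True by (simp add: wS_def)
  next
    case False
    have "nrm (fps_nth (E_ser p ^ p) n) \<le> 1"
      using growthD[OF growth_weight_power[OF weight_const_1 E_ser_growth_1]] by simp
    also have "wS p \<le> wS n" using False monoD[OF mono_wS] by simp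
    hence "1 \<le> 1 / real p * wS n" using p_pos by (simp add: wS_def field_simps)
    finally show ?thesis .
  qed
qed

lemma S_ring_subset_growth: "S_ring p nrm \<subseteq> growth wS"
  unfolding S_ring_def
proof (rule adjoin_series_subset_growth[OF weight_wS growthI])
  fix n
  have "nrm (fps_nth (E_ser p ^ p) n) \<le> 1 / real p * wS n" using growthD E_ser_power_p_growth .
  thus "nrm (fps_nth (fps_const (1 / of_nat p) * E_ser p ^ p) n) \<le> wS n"
    using p_pos by (simp add: nrm_mult nrm_divide nrm_p field_simps)
qed

text \<open>The Frobenius sends \<open>E\<close> to \<open>u ^ p + p\<close>. Since
  \<open>wS p = p\<close>, the leading coefficient costs nothing and every factor
  \<open>phi p (E_ser p)\<close> contributes a full \<open>1 / p\<close>. This is the source of the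
  gain in each approximation step.\<close>

lemma phi_E_ser_growth: "phi p (E_ser p) \<in> growth (\<lambda>n. 1 / real p * wS n)"
proof (rule growthI)
  fix n
  consider "n = 0" | "n = p" | "n \<noteq> 0" "n \<noteq> p" by blast
  thus "nrm (fps_nth (phi p (E_ser p)) n) \<le> 1 / real p * wS n"
  proof cases
    case 3
    hence "\<not> p dvd n \<or> n div p \<noteq> 0 \<and> n div p \<noteq> 1" using p_pos
      by (metis dvd_div_eq_0_iff dvd_mult_div_cancel mult.right_neutral)
    thus ?thesis using weight_nonneg[OF weight_wS, of n] by (auto simp: phi_nth p_pos E_ser_nth)
  qed (use p_pos in \<open>simp_all add: phi_nth E_ser_nth nrm_p wS_def\<close>)
qed

text \<open>Lets a constant be recovered from its product with \<open>E ^ n\<close>, as the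
  coefficient in degree \<open>n\<close>.\<close>

lemma E_ser_power_nth: "fps_nth (E_ser p ^ n :: 'a fps) n = 1 \<and> (\<forall>k>n. fps_nth (E_ser p ^ n :: 'a fps) k = 0)"
proof (induction n)
  case (Suc n)
  have "fps_nth (E_ser p ^ Suc n :: 'a fps) (Suc k)
      = fps_nth (E_ser p ^ n) k + of_nat p * fps_nth (E_ser p ^ n) (Suc k)" for k
    unfolding power_Suc E_ser_mult_nth_Suc ..
  moreover have "fps_nth (E_ser p ^ n :: 'a fps) (Suc k) = 0" if "k \<ge> n" for k
    using Suc that by simp
  ultimately show ?case using Suc by (auto simp: Suc_less_eq2)
qed simp

end

section \<open>The ideal \<open>I_ideal\<close> and the size of \<open>E\<close> over
  \<open>R\<close>\<close>

context uniformized_ext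
begin

text \<open>The bound for \<open>\<pi> * p ^ (c - 1)\<close> times a series in
  \<open>growth wS\<close>; it stands in for the ideal \<open>I_ideal\<close>.\<close>

definition wI :: "nat \<Rightarrow> nat \<Rightarrow> real" where
  "wI c n = nrm \<pi> * (1 / real p) ^ (c - 1) * wS n"

text \<open>Every \<open>E ^ p\<close> is worth \<open>1 / p\<close> in the weight
  \<open>wS\<close>, so \<open>E ^ (c * p)\<close> is worth \<open>(1 / p) ^ c\<close>. The summand
  with the extra factor \<open>E\<close> carries no \<open>\<pi>\<close>, but
  \<open>1 / p \<le> nrm \<pi>\<close> lets one of the \<open>c\<close> factors replace it.\<close>

lemma I_ideal_subset_growth:
  assumes "c \<ge> 1"
  shows "I_ideal p nrm \<pi> c \<subseteq> growth (wI c)"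
proof
  fix g assume "g \<in> I_ideal p nrm \<pi> c"
  then obtain x y z where g: "g = fps_const (\<pi> * of_nat p ^ (c - 1)) * x
        + fps_const \<pi> * (E_ser p ^ (c * p) * y) + E_ser p * (E_ser p ^ (c * p) * z)"
      and xyz: "x \<in> growth wS" "y \<in> growth wS" "z \<in> growth wS"
    unfolding I_ideal_def Fil_S_def using S_ring_subset_growth by blast
  have Ec: "E_ser p ^ (c * p) * s \<in> growth (\<lambda>n. (1 / real p) ^ c * wS n)" if "s \<in> growth wS" for s
  proof -
    have "(E_ser p ^ p) ^ c \<in> growth (\<lambda>n. (1 / real p) ^ c * wS n)"
      by (intro growth_weight_scaled_power weight_wS E_ser_power_p_growth) simp
    hence "(E_ser p ^ p) ^ c * s \<in> growth (\<lambda>n. (1 / real p) ^ c * 1 * wS n)"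
      using that by (intro growth_weight_scaled_mult weight_wS) auto
    thus ?thesis by (simp add: power_mult[symmetric] mult.commute)
  qed
  have const: "fps_const a * s \<in> growth (\<lambda>n. nrm a * b * wS n)" if "s \<in> growth (\<lambda>n. b * wS n)" for a s b
    using growthD[OF that] nrm_nonneg by (intro growthI) (simp add: nrm_mult mult.assoc mult_left_mono)
  have pc: "(1 / real p) ^ c = 1 / real p * (1 / real p) ^ (c - 1)"
    using assms by (metis Suc_diff_1 less_eq_Suc_le One_nat_def power_Suc)
  have "fps_const (\<pi> * of_nat p ^ (c - 1)) * x \<in> growth (wI c)"
    using const[of x 1 "\<pi> * of_nat p ^ (c - 1)"] xyz(1)
    by (simp add: wI_def[abs_def] nrm_mult nrm_power nrm_p)
  moreover have "fps_const \<pi> * (E_ser p ^ (c * p) * y) \<in> growth (wI c)"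
  proof (rule growth_mono[OF const[OF Ec[OF xyz(2)]]])
    fix n
    have "(1 / real p) ^ c \<le> (1 / real p) ^ (c - 1)" using p_ge_2 by (intro power_decreasing) auto
    thus "nrm \<pi> * (1 / real p) ^ c * wS n \<le> wI c n"
      unfolding wI_def using nrm_nonneg weight_nonneg[OF weight_wS] by (intro mult_right_mono mult_left_mono)
  qed
  moreover have "E_ser p * (E_ser p ^ (c * p) * z) \<in> growth (wI c)"
  proof (rule growth_mult[OF E_ser_growth_1 Ec[OF xyz(3)]])
    fix a n
    have "(1 / real p) ^ c * wS n \<le> nrm \<pi> * (1 / real p) ^ (c - 1) * wS (a + n)"
      unfolding pc using nrm_p_le_nrm_pi monoD[OF mono_wS, of n "a + n"] nrm_nonneg weight_nonneg[OF weight_wS]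
      by (intro mult_mono mult_right_mono) auto
    thus "1 * ((1 / real p) ^ c * wS n) \<le> wI c (a + n)" by (simp add: wI_def)
  qed
  ultimately show "g \<in> growth (wI c)" unfolding g by (intro growth_add)
qed

lemma E_ser_rho_growth: "E_ser p \<in> growth (\<lambda>n. 1 / rho * rho ^ n)"
proof (rule growthI)
  fix n
  have "1 / real p \<le> 1 / rho" using rho_ge_1 rho_le_p by (intro divide_left_mono) auto
  thus "nrm (fps_nth (E_ser p) n) \<le> 1 / rho * rho ^ n"
    using rho_ge_1 by (simp add: E_ser_nth nrm_p)
qed

end

section \<open>One approximation step\<close>

text \<open>The inclusion becomes the comparison \<open>wS n \<le> rho ^ n\<close> and forces
  \<open>rho > 1\<close>, which makes the corrections converge.\<close>

locale ramified_ext = uniformized_ext +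
  assumes S_subset_R: "S_ring p nrm \<subseteq> R_ring p nrm \<pi>"
begin

text \<open>Read off from the coefficient in degree \<open>p\<close> of \<open>E ^ p / p\<close>, an
  element of \<open>S\<close> and therefore of \<open>R\<close>.\<close>

lemma p_le_rho_power: "real p \<le> rho ^ p"
proof -
  let ?g = "fps_const (1 / of_nat p) * E_ser p ^ p :: 'a fps"
  have "?g ^ 1 \<in> S_ring p nrm" unfolding S_ring_def by (rule power_mem_adjoin_series)
  hence "?g \<in> growth (\<lambda>n. rho ^ n)" using S_subset_R R_ring_eq_growth by auto
  hence "nrm (fps_nth ?g p) \<le> rho ^ p" by (rule growthD)
  moreover have "fps_nth ?g p = 1 / of_nat p" using E_ser_power_nth[of p] by simp
  hence "nrm (fps_nth ?g p) = real p" by (simp only: nrm_divide nrm_p nrm_1) simp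
  ultimately show ?thesis by linarith
qed

lemma rho_gt_1: "1 < rho"
proof (rule ccontr)
  assume "\<not> 1 < rho"
  hence "rho = 1" using rho_ge_1 by simp
  thus False using p_le_rho_power p_ge_2 by simp
qed

lemma wS_le_rho: "wS n \<le> rho ^ n"
proof -
  have "wS n \<le> (rho ^ p) ^ (n div p)"
    unfolding wS_def by (intro power_mono p_le_rho_power) simp
  also have "\<dots> = rho ^ (p * (n div p))" by (simp add: power_mult)
  also have "\<dots> \<le> rho ^ n" using rho_ge_1 by (intro power_increasing) auto
  finally show ?thesis .
qed

text \<open>The invariant of the iteration. The integral part \<open>D\<close> is not fixed, because
  a step changes it by a multiple of \<open>\<pi>\<close>; its class given by \<open>A0\<close>
  persists. The factor \<open>g\<close> is a unit of \<open>growth wS\<close> and provides a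
  complementary matrix.\<close>

definition near_integral :: "nat \<Rightarrow> nat \<Rightarrow> 'a fps ^ 2 ^ 2 \<Rightarrow> 'a fps ^ 2 ^ 2 \<Rightarrow> bool" where
  "near_integral c k A0 A \<longleftrightarrow>
     (\<exists>D. A - D \<in> Mat (growth (wI c)) \<and> D - A0 \<in> Mat (growth (\<lambda>_. nrm \<pi>))) \<and>
     (\<exists>g\<in>growth wS. nrm (fps_nth g 0) = 1 \<and> det A = E_ser p ^ k * g)"

lemma congruent_integral:
  assumes "A0 \<in> Mat (growth (\<lambda>_. 1))" "D - A0 \<in> Mat (growth (\<lambda>_. nrm \<pi>))"
  shows "D \<in> Mat (growth (\<lambda>_. 1))"
proof -
  have "D - A0 \<in> Mat (growth (\<lambda>_. 1))"
    using nrm_pi_less_1 by (intro Mat_growth_mono[OF assms(2)]) simp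
  hence "A0 + (D - A0) \<in> Mat (growth (\<lambda>_. 1))" using assms(1) Mat_growth_add by blast
  thus ?thesis by simp
qed

lemma wI_le_wS: "wI c n \<le> wS n"
proof -
  have "nrm \<pi> * (1 / real p) ^ (c - 1) \<le> 1 * 1"
    using nrm_pi_less_1 nrm_nonneg p_ge_2 by (intro mult_mono power_le_one) auto
  hence "nrm \<pi> * (1 / real p) ^ (c - 1) * wS n \<le> 1 * wS n"
    using weight_nonneg[OF weight_wS] by (intro mult_right_mono) auto
  thus ?thesis by (simp add: wI_def)
qed

lemma Mat_frakS_le_S: "M \<in> Mat (growth (\<lambda>_. 1)) \<Longrightarrow> M \<in> Mat (growth wS)"
  using frakS_le_S unfolding Mat_def by blast

text \<open>Below degree \<open>c * p\<close> the weight \<open>wS\<close> is at most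
  \<open>p ^ (c - 1)\<close>, which reduces the bound \<open>wI c\<close> to
  \<open>nrm \<pi>\<close>. Shifting by \<open>c * p\<close> multiplies \<open>wS\<close> by
  \<open>p ^ c\<close>, and \<open>p * nrm \<pi>\<close> is \<open>rho\<close>.\<close>

lemma E_ser_power_division_I:
  assumes C: "C \<in> Mat (growth (wI c))" and c: "c \<ge> 1"
  shows "\<exists>L Q. C = L + mat (E_ser p ^ (c * p)) ** Q \<and> L \<in> Mat (growth (\<lambda>_. nrm \<pi>))
    \<and> Q \<in> Mat (growth (\<lambda>n. rho * wS n))"
proof -
  let ?a = "nrm \<pi> * (1 / real p) ^ (c - 1)"
  have a: "0 \<le> ?a" using nrm_nonneg by simp
  have "\<exists>l q. C $ i $ j = l + E_ser p ^ (c * p) * q \<and> l \<in> growth (\<lambda>_. nrm \<pi>)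
      \<and> q \<in> growth (\<lambda>n. wI c (n + c * p))" for i j
  proof (rule E_ser_power_division)
    show "C $ i $ j \<in> growth (wI c)" using C MatD by blast
    show "wI c (Suc n) \<le> real p * wI c n" for n
      using mult_left_mono[OF wS_Suc_le a, of n] by (simp add: wI_def ac_simps)
    have "(\<lambda>n. ?a * (wS n / real p ^ n)) \<longlonglongrightarrow> 0" by (rule tendsto_mult_right_zero[OF wS_null])
    thus "(\<lambda>n. wI c n / real p ^ n) \<longlonglongrightarrow> 0" by (simp add: wI_def)
    show "wI c n \<le> nrm \<pi>" if "n < c * p" for n
    proof -
      have "n div p < c" using that by (simp add: less_mult_imp_div_less)
      hence "wS n \<le> real p ^ (c - 1)" unfolding wS_def using p_ge_2 by (intro power_increasing) auto
      hence "?a * wS n \<le> ?a * real p ^ (c - 1)" using a by (intro mult_left_mono)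
      also have "\<dots> = nrm \<pi>" using p_pos by (simp add: power_one_over)
      finally show ?thesis by (simp add: wI_def)
    qed
  qed (simp add: nrm_nonneg)
  then obtain l q where lq: "\<And>i j. C $ i $ j = l i j + E_ser p ^ (c * p) * q i j"
      "\<And>i j. l i j \<in> growth (\<lambda>_. nrm \<pi>)" "\<And>i j. q i j \<in> growth (\<lambda>n. wI c (n + c * p))"
    by metis
  have eq: "wI c (n + c * p) = rho * wS n" for n
  proof -
    have "real p ^ c = real p * real p ^ (c - 1)" using c by (metis Suc_diff_1 less_eq_Suc_le One_nat_def power_Suc)
    thus ?thesis using p_pos by (simp add: wI_def wS_add_multiple rho_def power_one_over)
  qed
  show ?thesis
  proof (intro exI conjI)
    show "C = (\<chi> i j. l i j) + mat (E_ser p ^ (c * p)) ** (\<chi> i j. q i j)"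
      by (simp add: vec_eq_iff mat_scalar_mult_nth lq(1))
    show "(\<chi> i j. l i j) \<in> Mat (growth (\<lambda>_. nrm \<pi>))" by (simp add: Mat_def lq(2))
    show "(\<chi> i j. q i j) \<in> Mat (growth (\<lambda>n. rho * wS n))" using lq(3) by (simp add: Mat_def eq)
  qed
qed

text \<open>\<open>V\<close> is the inverse of \<open>1 + Z\<close>. The last clauses concern only
  \<open>phi_mat p V\<close>, since it acts on the matrix at the next index of the cycle.\<close>

definition correction :: "nat \<Rightarrow> nat \<Rightarrow> 'a fps ^ 2 ^ 2 \<Rightarrow> 'a fps ^ 2 ^ 2 \<Rightarrow> 'a fps ^ 2 ^ 2 \<Rightarrow> 'a fps ^ 2 ^ 2 \<Rightarrow> bool"
  where "correction c k A0 A Z V \<longleftrightarrow>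
    Z \<in> Mat (growth (\<lambda>n. (1 / rho) ^ c * rho ^ n)) \<and> V \<in> Mat (growth (\<lambda>n. rho ^ n)) \<and>
    (mat 1 + Z) ** V = mat 1 \<and> V ** (mat 1 + Z) = mat 1 \<and>
    (mat 1 + Z) ** A - A0 \<in> Mat (growth (\<lambda>_. nrm \<pi>)) \<and>
    (\<exists>h\<in>growth (\<lambda>_. 1). nrm (fps_nth h 0) = 1 \<and> det ((mat 1 + Z) ** A) = E_ser p ^ k * h) \<and>
    phi_mat p V - mat 1 \<in> Mat (growth (wI (Suc c))) \<and>
    det (phi_mat p V) \<in> growth wS \<and> nrm (fps_nth (det (phi_mat p V)) 0) = 1"

lemma integral_approximation_step:
  fixes A A0 :: "'a fps ^ 2 ^ 2"
  assumes c: "c \<ge> 1" and k: "k \<le> c * (p - 2)" and A0: "A0 \<in> Mat (growth (\<lambda>_. 1))"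
    and A: "near_integral c k A0 A"
  shows "\<exists>Z V. correction c k A0 A Z V"
proof -
  obtain D g where D: "A - D \<in> Mat (growth (wI c))" "D - A0 \<in> Mat (growth (\<lambda>_. nrm \<pi>))"
      and g: "g \<in> growth wS" "nrm (fps_nth g 0) = 1" "det A = E_ser p ^ k * g"
    using A unfolding near_integral_def by blast
  obtain L Q where LQ: "A - D = L + mat (E_ser p ^ (c * p)) ** Q" "L \<in> Mat (growth (\<lambda>_. nrm \<pi>))"
      "Q \<in> Mat (growth (\<lambda>n. rho * wS n))"
    using E_ser_power_division_I[OF D(1) c] by blast
  have AS: "A \<in> Mat (growth wS)"
  proof -
    have "A - D \<in> Mat (growth wS)" using Mat_growth_mono[OF D(1)] wI_le_wS by blast
    moreover have "D \<in> Mat (growth wS)" using congruent_integral[OF A0 D(2)] Mat_frakS_le_S by blast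
    ultimately have "(A - D) + D \<in> Mat (growth wS)" using Mat_growth_add by blast
    thus ?thesis by simp
  qed
  \<comment> \<open>\<open>B\<close> plays the role of \<open>E ^ k\<close> times the inverse of
    \<open>A\<close>, within the weight \<open>wS\<close>.\<close>
  obtain B where B: "B \<in> Mat (growth wS)" "A ** B = mat (E_ser p ^ k)" "B ** A = mat (E_ser p ^ k)"
    using complementary_matrix[OF weight_wS AS g(3,1,2)] by blast
  \<comment> \<open>The exponent left over after \<open>B\<close> has used up \<open>E ^ k\<close>.
    The bound on \<open>k\<close> and \<open>c \<ge> 1\<close> give
    \<open>N \<ge> 2 * c \<ge> Suc c\<close>: one factor \<open>E\<close> absorbs the
    \<open>rho\<close> in the bound of \<open>Q\<close>, and \<open>c\<close> factors
    remain.\<close>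
  define N where "N = c * p - k"
  have "c * p = c * (p - 2) + 2 * c" using p_ge_2 by (simp add: algebra_simps flip: distrib_left)
  hence N: "N \<ge> Suc c" "c * p = N + k" using k c by (auto simp: N_def)
  define Z where "Z = - (mat (E_ser p ^ N) ** (Q ** B))"
  have QB: "Q ** B \<in> Mat (growth (\<lambda>n. rho * wS n))"
    using Mat_growth_scaled_mult_right[OF weight_wS LQ(3) B(1)] rho_ge_1 by simp
  have Z: "Z \<in> Mat (growth (\<lambda>n. (1 / rho) ^ c * rho ^ n))"
  proof -
    have "mat (E_ser p ^ N) \<in> Mat (growth (\<lambda>n. (1 / rho) ^ N * rho ^ n))"
      using rho_ge_1 by (intro Mat_growth_mat growth_weight_scaled_power weight_rho E_ser_rho_growth) simp
    moreover have "Q ** B \<in> Mat (growth (\<lambda>n. rho * rho ^ n))"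
      using rho_ge_1 by (intro Mat_growth_mono[OF QB] mult_left_mono wS_le_rho) simp
    ultimately have "mat (E_ser p ^ N) ** (Q ** B) \<in> Mat (growth (\<lambda>n. (1 / rho) ^ N * rho * rho ^ n))"
      using rho_ge_1 by (intro Mat_growth_scaled_mult weight_rho) auto
    moreover have "(1 / rho) ^ N * rho * rho ^ n \<le> (1 / rho) ^ c * rho ^ n" for n
    proof -
      have "(1 / rho) ^ N \<le> (1 / rho) ^ Suc c" using N rho_ge_1 by (intro power_decreasing) auto
      hence "(1 / rho) ^ N * rho \<le> (1 / rho) ^ Suc c * rho" using rho_ge_1 by (intro mult_right_mono) auto
      also have "\<dots> = (1 / rho) ^ c" using rho_ge_1 by simp
      finally show ?thesis using rho_ge_1 by (intro mult_right_mono) auto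
    qed
    ultimately show ?thesis unfolding Z_def by (rule Mat_growth_minus[OF Mat_growth_mono])
  qed
  have rho_c: "(1 / rho) ^ c < 1"
  proof -
    have "(1 / rho) ^ c \<le> (1 / rho) ^ 1" using rho_gt_1 c by (intro power_decreasing) auto
    also have "\<dots> < 1" using rho_gt_1 by simp
    finally show ?thesis .
  qed
  have unit: "nrm (fps_nth (det (mat 1 + Z)) 0) = 1"
    using det_perturbation_unit[OF Z] rho_c by simp
  have "Z \<in> Mat (growth (\<lambda>n. rho ^ n))"
    using rho_c rho_ge_1 by (intro Mat_growth_mono[OF Z] mult_left_le_one_le) auto
  hence Z1: "mat 1 + Z \<in> Mat (growth (\<lambda>n. rho ^ n))"
    using Mat_growth_1[OF weight_rho] Mat_growth_add by blast
  obtain V where V: "V \<in> Mat (growth (\<lambda>n. rho ^ n))" "(mat 1 + Z) ** V = mat 1" "V ** (mat 1 + Z) = mat 1"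
    using complementary_matrix[OF weight_rho Z1, of 1] det_growth[OF weight_rho Z1] unit by auto
  have ZA: "(mat 1 + Z) ** A = D + L"
  proof -
    have "Z ** A = - (mat (E_ser p ^ N) ** (Q ** mat (E_ser p ^ k)))"
      unfolding Z_def matrix_uminus_left by (simp only: matrix_mul_assoc[symmetric] B(3))
    also have "\<dots> = - (mat (E_ser p ^ (c * p)) ** Q)"
      unfolding mat_scalar_commute[of Q] matrix_mul_assoc mat_scalar_mult N(2) power_add ..
    finally have "(mat 1 + Z) ** A = A - mat (E_ser p ^ (c * p)) ** Q"
      by (simp add: matrix_add_rdistrib)
    thus ?thesis using LQ(1) by (simp add: algebra_simps)
  qed
  have D': "(mat 1 + Z) ** A - A0 \<in> Mat (growth (\<lambda>_. nrm \<pi>))"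
  proof -
    have "(mat 1 + Z) ** A - A0 = (D - A0) + L" unfolding ZA by simp
    thus ?thesis using D(2) LQ(2) Mat_growth_add by metis
  qed
  \<comment> \<open>The cofactor \<open>det (mat 1 + Z) * g\<close> is at first only known to lie in
    \<open>R\<close>. Its product with \<open>E ^ k\<close> is the determinant of the integral
    matrix \<open>D + L\<close>, so saturation makes it integral.\<close>
  have h: "\<exists>h\<in>growth (\<lambda>_. 1). nrm (fps_nth h 0) = 1 \<and> det ((mat 1 + Z) ** A) = E_ser p ^ k * h"
  proof (intro bexI conjI)
    let ?h = "det (mat 1 + Z) * g"
    show det: "det ((mat 1 + Z) ** A) = E_ser p ^ k * ?h" using g(3) by (simp add: det_mul ac_simps)
    show "nrm (fps_nth ?h 0) = 1" using unit g(2) by (simp add: nrm_mult)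
    have "?h \<in> growth (\<lambda>n. rho ^ n)"
      using det_growth[OF weight_rho Z1] growth_mono[OF g(1) wS_le_rho]
      by (intro growth_weight_mult weight_rho)
    moreover have "E_ser p ^ k * ?h \<in> growth (\<lambda>_. 1)"
      unfolding det[symmetric] using congruent_integral[OF A0 D'] by (intro det_growth weight_const_1)
    ultimately show "?h \<in> growth (\<lambda>_. 1)" by (rule E_ser_power_saturated)
  qed
  let ?U = "phi_mat p V" and ?W = "phi_mat p Z"
  \<comment> \<open>The Frobenius turns each \<open>E\<close> into a factor of size
    \<open>1 / p\<close> in the weight \<open>wS\<close>; at least \<open>Suc c\<close> of them
    times \<open>rho = p * nrm \<pi>\<close> yield level \<open>Suc c\<close>.\<close>
  have W: "?W \<in> Mat (growth (wI (Suc c)))"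
  proof -
    have "mat (phi p (E_ser p) ^ N) \<in> Mat (growth (\<lambda>n. (1 / real p) ^ N * wS n))"
      by (intro Mat_growth_mat growth_weight_scaled_power weight_wS phi_E_ser_growth) simp
    moreover have "phi_mat p (Q ** B) \<in> Mat (growth (\<lambda>n. rho * wS n))"
      using rho_ge_1 by (intro phi_mat_growth QB mono_scaled_wS) simp
    ultimately have "mat (phi p (E_ser p) ^ N) ** phi_mat p (Q ** B)
        \<in> Mat (growth (\<lambda>n. (1 / real p) ^ N * rho * wS n))"
      using rho_ge_1 by (intro Mat_growth_scaled_mult weight_wS) auto
    moreover have "(1 / real p) ^ N * rho * wS n \<le> wI (Suc c) n" for n
    proof -
      have "(1 / real p) ^ N \<le> (1 / real p) ^ Suc c" using N p_ge_2 by (intro power_decreasing) auto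
      hence "(1 / real p) ^ N * rho \<le> (1 / real p) ^ Suc c * rho" using rho_ge_1 by (intro mult_right_mono) auto
      also have "\<dots> = nrm \<pi> * (1 / real p) ^ c" using p_pos by (simp add: rho_def)
      finally show ?thesis unfolding wI_def using weight_nonneg[OF weight_wS] by (intro mult_right_mono) auto
    qed
    ultimately have "- (mat (phi p (E_ser p) ^ N) ** phi_mat p (Q ** B)) \<in> Mat (growth (wI (Suc c)))"
      by (rule Mat_growth_minus[OF Mat_growth_mono])
    moreover have "phi_mat p Z = - (mat (phi p (E_ser p) ^ N) ** phi_mat p (Q ** B))"
      by (simp add: Z_def vec_eq_iff mat_scalar_mult_nth)
        (simp add: phi_mat_def phi_minus phi_mult phi_power p_pos mat_scalar_mult_nth)
    ultimately show ?thesis by simp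
  qed
  have W1: "mat 1 + ?W \<in> Mat (growth wS)"
    using Mat_growth_mono[OF W wI_le_wS] Mat_growth_1[OF weight_wS] Mat_growth_add by blast
  have "wI (Suc c) 0 < 1"
  proof -
    have "nrm \<pi> * (1 / real p) ^ c \<le> nrm \<pi> * 1"
      using nrm_nonneg p_ge_2 by (intro mult_left_mono power_le_one) auto
    thus ?thesis using nrm_pi_less_1 by (simp add: wI_def)
  qed
  hence unitW: "nrm (fps_nth (det (mat 1 + ?W)) 0) = 1" by (rule det_perturbation_unit[OF W])
  have UW: "(mat 1 + ?W) ** ?U = mat 1" "?U ** (mat 1 + ?W) = mat 1"
    using arg_cong[OF V(2), of "phi_mat p"] arg_cong[OF V(3), of "phi_mat p"]
    by (simp_all add: phi_mat_mult phi_mat_add p_pos)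
  \<comment> \<open>The bound on \<open>V\<close> is only \<open>rho ^ n\<close>. The sharper bound
    \<open>wS\<close> for its Frobenius image comes from inverting \<open>mat 1 + ?W\<close> within
    that weight and from uniqueness of inverses.\<close>
  obtain U' where U': "U' \<in> Mat (growth wS)" "(mat 1 + ?W) ** U' = mat 1"
    using complementary_matrix[OF weight_wS W1, of 1] det_growth[OF weight_wS W1] unitW by auto
  hence US: "?U \<in> Mat (growth wS)" using matrix_left_inverse_unique[OF UW(2) U'(2)] by simp
  have "?U - mat 1 = - (?W ** ?U)" using UW(1) by (simp add: matrix_add_rdistrib eq_neg_iff_add_eq_0 algebra_simps)
  moreover have "?W ** ?U \<in> Mat (growth (wI (Suc c)))"
    using Mat_growth_scaled_mult_right[OF weight_wS, of ?W "nrm \<pi> * (1 / real p) ^ c" ?U] W US nrm_nonneg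
    by (simp add: wI_def[abs_def])
  ultimately have "?U - mat 1 \<in> Mat (growth (wI (Suc c)))" using Mat_growth_minus by metis
  moreover have "det ?U \<in> growth wS" using det_growth[OF weight_wS US] .
  moreover have "nrm (fps_nth (det ?U) 0) = 1"
    using det_const_coeff_unit(2)[OF weight_wS wS_0 W1 US UW(1)] .
  ultimately show ?thesis unfolding correction_def using Z V D' h by blast
qed

text \<open>The corrections are chosen independently for each index. The new integral part is
  \<open>(mat 1 + Z i) ** A i\<close>; multiplying it by the Frobenius image of the previous
  \<open>V\<close>, which is 1 up to level \<open>Suc c\<close>, creates an error of level
  \<open>Suc c\<close>.\<close>

lemma integral_approximation_step_tuple:
  fixes A A0 :: "nat \<Rightarrow> 'a fps ^ 2 ^ 2"
  assumes f: "f \<ge> 1" and c: "c \<ge> 1" and k: "\<forall>i<f. k i \<le> c * (p - 2)"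
    and A0: "\<forall>i<f. A0 i \<in> Mat (growth (\<lambda>_. 1))"
    and A: "\<forall>i<f. near_integral c (k i) (A0 i) (A i)"
  shows "\<exists>Z V. \<forall>i<f. Z i \<in> Mat (growth (\<lambda>n. (1 / rho) ^ c * rho ^ n)) \<and> V i \<in> Mat (growth (\<lambda>n. rho ^ n)) \<and>
    (mat 1 + Z i) ** V i = mat 1 \<and> V i ** (mat 1 + Z i) = mat 1 \<and>
    near_integral (Suc c) (k i) (A0 i) ((mat 1 + Z i) ** A i ** phi_mat p (V ((i + f - 1) mod f)))"
proof -
  have "\<exists>Z V. correction c (k i) (A0 i) (A i) Z V" if "i < f" for i
    by (rule integral_approximation_step[OF c]) (use k A0 A that in auto)
  then obtain Z V where "\<And>i. i < f \<Longrightarrow> correction c (k i) (A0 i) (A i) (Z i) (V i)" by metis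
  note ZV = this[unfolded correction_def]
  have "near_integral (Suc c) (k i) (A0 i) ((mat 1 + Z i) ** A i ** phi_mat p (V ((i + f - 1) mod f)))"
    if i: "i < f" for i
  proof -
    let ?D = "(mat 1 + Z i) ** A i" and ?U = "phi_mat p (V ((i + f - 1) mod f))"
    have j: "(i + f - 1) mod f < f" using f by simp
    have "?D \<in> Mat (growth wS)"
      using congruent_integral ZV[OF i] A0 i Mat_frakS_le_S by blast
    hence "?D ** (?U - mat 1) \<in> Mat (growth (wI (Suc c)))"
      using Mat_growth_scaled_mult_left[OF weight_wS, of ?D "?U - mat 1" "nrm \<pi> * (1 / real p) ^ c"]
        ZV[OF j] nrm_nonneg by (simp add: wI_def[abs_def])
    hence 1: "?D ** ?U - ?D \<in> Mat (growth (wI (Suc c)))" by (simp add: matrix_diff_ldistrib)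
    obtain h where h: "h \<in> growth (\<lambda>_. 1)" "nrm (fps_nth h 0) = 1" "det ?D = E_ser p ^ k i * h"
      using ZV[OF i] by blast
    have "h * det ?U \<in> growth wS" using ZV[OF j] h(1) frakS_le_S growth_weight_mult[OF weight_wS] by blast
    moreover have "nrm (fps_nth (h * det ?U) 0) = 1" using ZV[OF j] h(2) by (simp add: nrm_mult)
    moreover have "det (?D ** ?U) = E_ser p ^ k i * (h * det ?U)"
      unfolding det_mul[of ?D] h(3) by (simp only: mult.assoc)
    ultimately show ?thesis unfolding near_integral_def using 1 ZV[OF i] by blast
  qed
  thus ?thesis using ZV by blast
qed

end

section \<open>Passage to the limit\<close>

context finite_ext_Qp
begin

text \<open>Each coefficient of a product or of a Frobenius image depends on finitely many
  coefficients, so this notion of limit commutes with both operations.\<close>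

definition mat_tends :: "(nat \<Rightarrow> 'a fps ^ 'n ^ 'n) \<Rightarrow> 'a fps ^ 'n ^ 'n \<Rightarrow> bool" where
  "mat_tends M L \<longleftrightarrow> (\<forall>i j k. tends (\<lambda>n. fps_nth (M n $ i $ j) k) (fps_nth (L $ i $ j) k))"

lemma mat_tends_const: "mat_tends (\<lambda>_. L) L"
  by (simp add: mat_tends_def tends_const)

lemma mat_tends_mult:
  assumes "mat_tends M L" "mat_tends M' L'"
  shows "mat_tends (\<lambda>n. M n ** M' n) (L ** L')"
  using assms unfolding mat_tends_def matrix_matrix_mult_def
  by (simp add: fps_sum_nth fps_mult_nth) (intro allI tends_sum tends_mult; simp)

lemma mat_tends_diff:
  assumes "mat_tends M L" "mat_tends M' L'"
  shows "mat_tends (\<lambda>n. M n - M' n) (L - L')"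
  using assms unfolding mat_tends_def by (simp add: tends_diff)

lemma mat_tends_phi_mat: "mat_tends M L \<Longrightarrow> mat_tends (\<lambda>n. phi_mat p (M n)) (phi_mat p L)"
  by (simp add: mat_tends_def phi_mat_def phi_nth p_pos tends_const)

lemma mat_tends_unique:
  assumes "mat_tends M L" "mat_tends M L'" shows "L = L'"
  unfolding vec_eq_iff fps_eq_iff
proof (intro allI)
  fix i j k
  show "fps_nth (L $ i $ j) k = fps_nth (L' $ i $ j) k"
    using assms unfolding mat_tends_def by (intro tends_unique) auto
qed

lemma mat_tends_growth:
  assumes "mat_tends M L" "\<And>n. M n \<in> Mat (growth w)"
  shows "L \<in> Mat (growth w)"
proof (intro MatI growthI)
  fix i j k
  have "nrm (fps_nth (M n $ i $ j) k) \<le> w k" for n using growthD[OF MatD[OF assms(2)]] .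
  thus "nrm (fps_nth (L $ i $ j) k) \<le> w k"
    using assms(1) unfolding mat_tends_def by (blast intro: tends_nrm_le)
qed

text \<open>Convergence is tested in each degree separately: \<open>e n\<close> tends to 0 while
  \<open>u k\<close> may grow with the degree.\<close>

lemma mat_tends_exists:
  assumes "\<And>n. M (Suc n) - M n \<in> Mat (growth (\<lambda>k. e n * u k))" "e \<longlonglongrightarrow> 0"
  shows "\<exists>L. mat_tends M L"
proof -
  have "\<exists>x. tends (\<lambda>n. fps_nth (M n $ i $ j) k) x" for i j k
  proof (rule tends_of_null_differences, rule Lim_null_comparison)
    show "\<forall>\<^sub>F n in sequentially.
        norm (nrm (fps_nth (M (Suc n) $ i $ j) k - fps_nth (M n $ i $ j) k)) \<le> e n * u k"
      using growthD[OF MatD[OF assms(1)], of _ i j k] nrm_nonneg by simp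
    show "(\<lambda>n. e n * u k) \<longlonglongrightarrow> 0" using assms(2) by (rule tendsto_mult_left_zero)
  qed
  then obtain x where x: "\<And>i j k. tends (\<lambda>n. fps_nth (M n $ i $ j) k) (x i j k)" by metis
  hence "mat_tends M (\<chi> i j. Abs_fps (x i j))" by (simp add: mat_tends_def)
  thus ?thesis by blast
qed

lemma mat_tends_0:
  assumes "\<And>n. M n \<in> Mat (growth (\<lambda>k. e n * u k))" "e \<longlonglongrightarrow> 0"
  shows "mat_tends M 0"
  unfolding mat_tends_def tends_def
proof (intro allI, rule Lim_null_comparison)
  fix i j k
  show "\<forall>\<^sub>F n in sequentially. norm (nrm (fps_nth (M n $ i $ j) k - fps_nth (0 $ i $ j) k)) \<le> e n * u k"
    using growthD[OF MatD[OF assms(1)], of _ i j k] nrm_nonneg by simp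
  show "(\<lambda>n. e n * u k) \<longlonglongrightarrow> 0" using assms(2) by (rule tendsto_mult_left_zero)
qed

section \<open>Inverting \<open>p\<close>\<close>

lemma invert_p_growth_scale:
  assumes "weight w" "fps_const (of_nat p ^ n) * x \<in> growth w"
  shows "fps_const (of_nat p ^ (m + n)) * x \<in> growth w"
proof -
  have "fps_const (of_nat p ^ m) \<in> growth w"
    using weight_ge_1[OF assms(1), of 0] weight_nonneg[OF assms(1)] p_ge_2
    by (intro growth_const order_trans[OF _ weight_ge_1[OF assms(1), of 0]])
      (simp_all add: nrm_power nrm_p power_le_one)
  hence "fps_const (of_nat p ^ m) * (fps_const (of_nat p ^ n) * x) \<in> growth w"
    using assms growth_weight_mult by blast
  thus ?thesis by (simp add: power_add mult.assoc[symmetric])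
qed

lemma invert_p_add:
  assumes "weight w" "x \<in> invert_p p (growth w)" "y \<in> invert_p p (growth w)"
  shows "x + y \<in> invert_p p (growth w)"
proof -
  obtain n m where "fps_const (of_nat p ^ n) * x \<in> growth w" "fps_const (of_nat p ^ m) * y \<in> growth w"
    using assms unfolding invert_p_def by blast
  hence "fps_const (of_nat p ^ (m + n)) * x \<in> growth w" "fps_const (of_nat p ^ (n + m)) * y \<in> growth w"
    using invert_p_growth_scale[OF assms(1)] by blast+
  hence "fps_const (of_nat p ^ (n + m)) * (x + y) \<in> growth w"
    by (simp add: distrib_left add.commute growth_add)
  thus ?thesis unfolding invert_p_def by blast
qed

lemma invert_p_mult:
  assumes "weight w" "x \<in> invert_p p (growth w)" "y \<in> invert_p p (growth w)"
  shows "x * y \<in> invert_p p (growth w)"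
proof -
  obtain n m where "fps_const (of_nat p ^ n) * x \<in> growth w" "fps_const (of_nat p ^ m) * y \<in> growth w"
    using assms unfolding invert_p_def by blast
  hence "(fps_const (of_nat p ^ n) * x) * (fps_const (of_nat p ^ m) * y) \<in> growth w"
    using assms(1) growth_weight_mult by blast
  moreover have "(fps_const (of_nat p ^ n) * x) * (fps_const (of_nat p ^ m) * y)
      = (fps_const (of_nat p ^ n) * fps_const (of_nat p ^ m)) * (x * y)" by (simp only: ac_simps)
  ultimately have "fps_const (of_nat p ^ (n + m)) * (x * y) \<in> growth w" by (simp add: power_add)
  thus ?thesis unfolding invert_p_def by blast
qed

lemma subset_invert_p: "T \<subseteq> invert_p p T"
  unfolding invert_p_def by (auto intro: exI[of _ 0])

text \<open>A high enough power of \<open>p\<close> makes any constant integral, by the Archimedean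
  property of the reals.\<close>

lemma fps_const_invert_p:
  assumes "weight w" shows "fps_const a \<in> invert_p p (growth w)"
proof -
  obtain n where "nrm a < real p ^ n"
    using real_arch_pow[of "real p" "nrm a"] p_ge_2 by auto
  hence "nrm (of_nat p ^ n * a) \<le> 1"
    using p_pos by (simp add: nrm_mult nrm_power nrm_p power_one_over)
  hence "fps_const (of_nat p ^ n * a) \<in> growth w"
    using weight_ge_1[OF assms, of 0] weight_nonneg[OF assms] by (intro growth_const) auto
  thus ?thesis unfolding invert_p_def by auto
qed

lemma Mat_invert_p_mult:
  assumes "weight w" "M \<in> Mat (invert_p p (growth w))" "N \<in> Mat (invert_p p (growth w))"
  shows "M ** N \<in> Mat (invert_p p (growth w))"
proof (rule MatI)
  fix i j
  have "(\<Sum>k\<in>K. M $ i $ k * N $ k $ j) \<in> invert_p p (growth w)" for K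
    using fps_const_invert_p[OF assms(1), of 0] assms
    by (induction K rule: infinite_finite_induct) (auto intro!: invert_p_add invert_p_mult MatD)
  thus "(M ** N) $ i $ j \<in> invert_p p (growth w)" by (simp add: matrix_matrix_mult_def)
qed

lemma diag2_mult: "diag2 x y ** diag2 x' y' = diag2 (x * x') (y * y' :: 'a)"
  by (simp add: diag2_def vec_eq_iff forall_2 matrix_matrix_mult_def sum_2)

lemma diag2_1: "diag2 1 (1 :: 'a) = mat 1"
  by (simp add: diag2_def vec_eq_iff forall_2 mat_def)

lemma diag2_invert_p: "weight w \<Longrightarrow> diag2 x y \<in> Mat (invert_p p (growth w))"
  using fps_const_invert_p[of w 0]
  by (simp add: Mat_def diag2_def forall_2 fps_const_invert_p)

lemma det_diag2: "det (diag2 x y) = fps_const (x * y :: 'a)"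
  by (simp add: det_2 diag2_def)

end

text \<open>For the telescoping of determinants around the cycle: passing to the previous index
  permutes the indices below \<open>f\<close>.\<close>

lemma prod_cyclic_shift:
  assumes "f \<ge> (1 :: nat)"
  shows "(\<Prod>i<f. g ((i + f - 1) mod f)) = (\<Prod>i<f. g i)"
proof (rule prod.reindex_bij_witness[where i = "\<lambda>i. Suc i mod f" and j = "\<lambda>i. (i + f - 1) mod f"])
  fix i assume i: "i \<in> {..<f}"
  have "Suc ((i + f - 1) mod f) mod f = Suc (i + f - 1) mod f" by (rule mod_Suc_eq)
  thus "Suc ((i + f - 1) mod f) mod f = i" using i assms by simp
  have "(Suc i mod f + (f - 1)) mod f = (Suc i + (f - 1)) mod f" by (rule mod_add_left_eq)
  thus "(Suc i mod f + f - 1) mod f = i" using i assms by simp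
qed (use assms in auto)

lemma prod_eq_1_imp_eq_1:
  fixes g :: "'b \<Rightarrow> real"
  assumes "finite I" "\<And>i. i \<in> I \<Longrightarrow> 0 \<le> g i \<and> g i \<le> 1" "(\<Prod>i\<in>I. g i) = 1" "j \<in> I"
  shows "g j = 1"
proof -
  have "(\<Prod>i\<in>I. g i) = g j * (\<Prod>i\<in>I - {j}. g i)" using assms by (intro prod.remove)
  also have "\<dots> \<le> g j * 1" using assms by (intro mult_left_mono prod_le_1) auto
  finally show ?thesis using assms(2)[OF assms(4)] assms(3) by simp
qed

section \<open>The infinite product of the corrections\<close>

context ramified_ext
begin

text \<open>The step is iterated by dependent choice at the levels \<open>c + n\<close>; the bound
  on \<open>k i\<close> only becomes weaker as the level rises.\<close>

lemma integral_form_exists: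
  fixes A A0 :: "nat \<Rightarrow> 'a fps ^ 2 ^ 2"
  assumes f: "f \<ge> 1" and c: "c \<ge> 1" and k: "\<forall>i<f. k i \<le> c * (p - 2)"
    and A0: "\<forall>i<f. A0 i \<in> Mat (growth (\<lambda>_. 1))"
    and A: "\<forall>i<f. near_integral c (k i) (A0 i) (A i)"
  shows "\<exists>Y V. \<forall>i<f. Y i \<in> Mat (growth (\<lambda>n. rho ^ n)) \<and> V i \<in> Mat (growth (\<lambda>n. rho ^ n)) \<and>
    Y i ** V i = mat 1 \<and> V i ** Y i = mat 1 \<and>
    Y i ** A i ** phi_mat p (V ((i + f - 1) mod f)) \<in> Mat_height p (k i) (growth (\<lambda>_. 1)) \<and>
    Y i ** A i ** phi_mat p (V ((i + f - 1) mod f)) - A0 i \<in> Mat (growth (\<lambda>_. nrm \<pi>))"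
proof -
  let ?R = "Mat (growth (\<lambda>n. rho ^ n)) :: ('a fps ^ 2 ^ 2) set"
  let ?prev = "\<lambda>i. (i + f - 1) mod f"
  have prev: "?prev i < f" for i using f by simp
  \<comment> \<open>A state holds a transformation together with its inverse, so the conjugation is
    expressed without \<open>matrix_inv\<close>.\<close>
  define act where "act S i = fst (S i) ** A i ** phi_mat p (snd (S (?prev i)))"
    for S :: "nat \<Rightarrow> ('a fps ^ 2 ^ 2) \<times> ('a fps ^ 2 ^ 2)" and i
  define P where "P n S \<longleftrightarrow> (\<forall>i<f. fst (S i) \<in> ?R \<and> snd (S i) \<in> ?R \<and>
      fst (S i) ** snd (S i) = mat 1 \<and> snd (S i) ** fst (S i) = mat 1 \<and>
      near_integral (c + n) (k i) (A0 i) (act S i))" for n S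
  define close where "close n S S' \<longleftrightarrow> (\<forall>i<f.
      fst (S' i) - fst (S i) \<in> Mat (growth (\<lambda>j. (1 / rho) ^ (c + n) * rho ^ j)) \<and>
      snd (S' i) - snd (S i) \<in> Mat (growth (\<lambda>j. (1 / rho) ^ (c + n) * rho ^ j)))"
    for n and S S' :: "nat \<Rightarrow> ('a fps ^ 2 ^ 2) \<times> ('a fps ^ 2 ^ 2)"
  have "P 0 (\<lambda>_. (mat 1, mat 1))"
    using A Mat_growth_1[OF weight_rho, where 'b = 2] by (simp add: P_def act_def)
  moreover have "\<exists>S'. P (Suc n) S' \<and> close n S S'" if S: "P n S" for n S
  proof -
    have cn: "c + n \<ge> 1" "\<forall>i<f. k i \<le> (c + n) * (p - 2)"
      using c k by (auto simp: distrib_right intro: trans_le_add1)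
    have "\<forall>i<f. near_integral (c + n) (k i) (A0 i) (act S i)" using S by (simp add: P_def)
    from integral_approximation_step_tuple[OF f cn A0 this] obtain Z V where ZV:
      "\<And>i. i < f \<Longrightarrow> Z i \<in> Mat (growth (\<lambda>j. (1 / rho) ^ (c + n) * rho ^ j)) \<and> V i \<in> ?R \<and>
        (mat 1 + Z i) ** V i = mat 1 \<and> V i ** (mat 1 + Z i) = mat 1 \<and>
        near_integral (Suc (c + n)) (k i) (A0 i) ((mat 1 + Z i) ** act S i ** phi_mat p (V (?prev i)))"
      by blast
    define S' where "S' i = ((mat 1 + Z i) ** fst (S i), snd (S i) ** V i)" for i
    have "P (Suc n) S' \<and> close n S S'"
      unfolding P_def close_def
    proof (intro conjI allI impI)
      fix i assume i: "i < f"
      note Si = S[unfolded P_def, rule_format, OF i] and ZVi = ZV[OF i]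
      have e: "(0::real) \<le> (1 / rho) ^ (c + n)" using rho_ge_1 by simp
      have ZY: "Z i ** fst (S i) \<in> Mat (growth (\<lambda>j. (1 / rho) ^ (c + n) * rho ^ j))"
        using Mat_growth_scaled_mult_right[OF weight_rho _ _ e] ZVi Si by blast
      have Y': "fst (S' i) = fst (S i) + Z i ** fst (S i)"
        by (simp add: S'_def matrix_add_rdistrib)
      show "fst (S' i) - fst (S i) \<in> Mat (growth (\<lambda>j. (1 / rho) ^ (c + n) * rho ^ j))"
        using ZY by (simp add: Y')
      have "(1 / rho) ^ (c + n) * rho ^ j \<le> rho ^ j" for j
        using rho_ge_1 by (intro mult_left_le_one_le power_le_one) auto
      hence "Z i ** fst (S i) \<in> ?R" using Mat_growth_mono[OF ZY] by blast
      thus "fst (S' i) \<in> ?R" using Si Y' Mat_growth_add by metis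
      show VR: "snd (S' i) \<in> ?R"
        unfolding S'_def snd_conv using Si ZVi by (intro Mat_growth_weight_mult weight_rho) auto
      \<comment> \<open>As \<open>V i\<close> is inverse to \<open>mat 1 + Z i\<close>, the old
        inverse is the new one times \<open>mat 1 + Z i\<close>, so the two differ by a multiple of
        the small matrix \<open>Z i\<close>.\<close>
      have "snd (S i) ** V i ** (mat 1 + Z i) = snd (S i)"
        using ZVi by (simp add: matrix_mul_assoc[symmetric])
      hence "snd (S' i) - snd (S i) = - (snd (S' i) ** Z i)"
        by (simp add: S'_def matrix_add_ldistrib algebra_simps)
      moreover have "snd (S' i) ** Z i \<in> Mat (growth (\<lambda>j. (1 / rho) ^ (c + n) * rho ^ j))"
        using Mat_growth_scaled_mult_left[OF weight_rho VR _ e] ZVi by blast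
      ultimately show "snd (S' i) - snd (S i) \<in> Mat (growth (\<lambda>j. (1 / rho) ^ (c + n) * rho ^ j))"
        using Mat_growth_minus by metis
      have "fst (S' i) ** snd (S' i) = (mat 1 + Z i) ** (fst (S i) ** snd (S i)) ** V i"
        by (simp add: S'_def matrix_mul_assoc)
      thus "fst (S' i) ** snd (S' i) = mat 1" using Si ZVi by simp
      have "snd (S' i) ** fst (S' i) = snd (S i) ** (V i ** (mat 1 + Z i)) ** fst (S i)"
        by (simp add: S'_def matrix_mul_assoc)
      thus "snd (S' i) ** fst (S' i) = mat 1" using Si ZVi by simp
      have "act S' i = (mat 1 + Z i) ** act S i ** phi_mat p (V (?prev i))"
        by (simp add: act_def S'_def phi_mat_mult p_pos matrix_mul_assoc)
      thus "near_integral (c + Suc n) (k i) (A0 i) (act S' i)" using ZVi by simp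
    qed
    thus ?thesis by blast
  qed
  ultimately obtain S where S: "\<And>n. P n (S n)" "\<And>n. close n (S n) (S (Suc n))"
    using dependent_nat_choice[of P close] by blast
  have null: "(\<lambda>n. (1 / rho) ^ (c + n)) \<longlonglongrightarrow> 0"
    using rho_gt_1 LIMSEQ_ignore_initial_segment[OF LIMSEQ_realpow_zero[of "1 / rho"], of c]
    by (simp add: add.commute)
  have "\<exists>Y V. mat_tends (\<lambda>n. fst (S n i)) Y \<and> mat_tends (\<lambda>n. snd (S n i)) V" if "i < f" for i
  proof -
    have "\<exists>Y. mat_tends (\<lambda>n. fst (S n i)) Y" "\<exists>V. mat_tends (\<lambda>n. snd (S n i)) V"
      using S(2) that unfolding close_def
      by (auto intro!: mat_tends_exists[where u = "\<lambda>j. rho ^ j", OF _ null])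
    thus ?thesis by blast
  qed
  then obtain Y V where lim: "\<And>i. i < f \<Longrightarrow> mat_tends (\<lambda>n. fst (S n i)) (Y i)"
      "\<And>i. i < f \<Longrightarrow> mat_tends (\<lambda>n. snd (S n i)) (V i)" by metis
  show ?thesis
  proof (intro exI allI impI conjI)
    fix i assume i: "i < f"
    let ?j = "?prev i" and ?L = "Y i ** A i ** phi_mat p (V (?prev i))"
    have YR: "Y i \<in> ?R" and VR: "V i \<in> ?R" if "i < f" for i
      using S(1) lim[OF that] that unfolding P_def by (auto intro: mat_tends_growth)
    show "Y i \<in> ?R" "V i \<in> ?R" using YR VR i by auto
    have YV: "Y i ** V i = mat 1" if "i < f" for i
      using mat_tends_mult[OF lim(1) lim(2), OF that that] S(1) that mat_tends_const
      unfolding P_def by (auto intro: mat_tends_unique)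
    show "Y i ** V i = mat 1" using YV i .
    show "V i ** Y i = mat 1"
      using mat_tends_mult[OF lim(2) lim(1), OF i i] S(1) i mat_tends_const
      unfolding P_def by (auto intro: mat_tends_unique)
    have actL: "mat_tends (\<lambda>n. act (S n) i) ?L"
      unfolding act_def by (intro mat_tends_mult mat_tends_const mat_tends_phi_mat lim i prev)
    have "\<exists>D. act (S n) i - D \<in> Mat (growth (wI (c + n))) \<and> D - A0 i \<in> Mat (growth (\<lambda>_. nrm \<pi>))" for n
      using S(1) i unfolding P_def near_integral_def by blast
    then obtain D where D: "\<And>n. act (S n) i - D n \<in> Mat (growth (wI (c + n)))"
        "\<And>n. D n - A0 i \<in> Mat (growth (\<lambda>_. nrm \<pi>))" by metis
    \<comment> \<open>The errors of level \<open>c + n\<close> tend to 0, so the integral parts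
      \<open>D n\<close> share the limit, and their congruence to \<open>A0 i\<close> passes to
      it.\<close>
    have "mat_tends (\<lambda>n. act (S n) i - D n) 0"
    proof (rule mat_tends_0)
      show "act (S n) i - D n \<in> Mat (growth (\<lambda>j. nrm \<pi> * (1 / real p) ^ (c + n - 1) * wS j))" for n
        using D(1)[of n] by (simp add: wI_def[abs_def])
      have "(\<lambda>n. (1 / real p) ^ (n + (c - 1))) \<longlonglongrightarrow> 0"
        using p_ge_2 by (intro LIMSEQ_ignore_initial_segment LIMSEQ_realpow_zero) auto
      moreover have "c + n - 1 = n + (c - 1)" for n using c by simp
      ultimately show "(\<lambda>n. nrm \<pi> * (1 / real p) ^ (c + n - 1)) \<longlonglongrightarrow> 0"
        by (simp only:) (rule tendsto_mult_right_zero)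
    qed
    from mat_tends_diff[OF mat_tends_diff[OF actL this] mat_tends_const[of "A0 i"]]
    have "mat_tends (\<lambda>n. D n - A0 i) (?L - A0 i)" by simp
    thus LA0: "?L - A0 i \<in> Mat (growth (\<lambda>_. nrm \<pi>))" using D(2) by (rule mat_tends_growth)
    have L: "?L \<in> Mat (growth (\<lambda>_. 1))" using congruent_integral[OF _ LA0] A0 i by blast
    obtain g where g: "g \<in> growth wS" "nrm (fps_nth g 0) = 1" "det (A i) = E_ser p ^ k i * g"
      using A i unfolding near_integral_def by blast
    \<comment> \<open>The height of the limit is read off from its determinant; the cofactor is
      first seen in \<open>R\<close> and then becomes integral by saturation.\<close>
    define h where "h = det (Y i) * g * det (phi_mat p (V ?j))"
    have det: "det ?L = E_ser p ^ k i * h"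
      unfolding det_mul g(3) h_def by (simp only: ac_simps)
    have "mono (\<lambda>n. rho ^ n)" using rho_ge_1 by (auto simp: mono_def intro: power_increasing)
    hence phiV: "phi_mat p (V ?j) \<in> ?R" by (intro phi_mat_growth VR prev)
    have "h \<in> growth (\<lambda>n. rho ^ n)"
      unfolding h_def using growth_mono[OF g(1) wS_le_rho] YR[OF i] phiV
      by (intro growth_weight_mult det_growth weight_rho)
    moreover have "E_ser p ^ k i * h \<in> growth (\<lambda>_. 1)"
      unfolding det[symmetric] by (rule det_growth[OF weight_const_1 L])
    ultimately have h1: "h \<in> growth (\<lambda>_. 1)" by (rule E_ser_power_saturated)
    have "nrm (fps_nth (det (Y i)) 0) = 1"
      using det_const_coeff_unit(1)[OF weight_rho _ YR[OF i] VR[OF i] YV[OF i]] by simp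
    \<comment> \<open>The Frobenius does not change constant coefficients.\<close>
    moreover have "nrm (fps_nth (det (phi_mat p (V ?j))) 0) = 1"
      using det_const_coeff_unit(2)[OF weight_rho _ YR[OF prev] VR[OF prev] YV[OF prev]]
      by (simp add: phi_det_2[symmetric] phi_nth p_pos)
    ultimately have h0: "nrm (fps_nth h 0) = 1" using g(2) by (simp add: h_def nrm_mult)
    show "?L \<in> Mat_height p (k i) (growth (\<lambda>_. 1))"
      unfolding Mat_height_def using L complementary_matrix[OF weight_const_1 L det h1 h0] by blast
  qed
qed

section \<open>Composing the given transformations\<close>

lemma S_invert_p_subset: "invert_p p (S_ring p nrm) \<subseteq> invert_p p (growth (\<lambda>n. rho ^ n))"
  using S_subset_R unfolding invert_p_def R_ring_eq_growth by blast

text \<open>Extracts what both kinds of transformation have in common: an inverse over R[1/p] and a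
  determinant that is a nonzero constant.\<close>

lemma transformation_inverse:
  fixes X :: "'a fps ^ 2 ^ 2"
  assumes "(X \<in> GL (invert_p p (S_ring p nrm)) \<and> det X = 1) \<or>
    (\<exists>x y. x \<noteq> 0 \<and> y \<noteq> 0 \<and> X = diag2 x y)"
  shows "\<exists>W d. X \<in> Mat (invert_p p (growth (\<lambda>n. rho ^ n))) \<and> W \<in> Mat (invert_p p (growth (\<lambda>n. rho ^ n))) \<and>
    X ** W = mat 1 \<and> W ** X = mat 1 \<and> d \<noteq> 0 \<and> det X = fps_const d"
  using assms
proof
  assume X: "X \<in> GL (invert_p p (S_ring p nrm)) \<and> det X = 1"
  then obtain W where "W \<in> Mat (invert_p p (S_ring p nrm))" "X ** W = mat 1" "W ** X = mat 1"
    unfolding GL_def by blast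
  moreover have "X \<in> Mat (invert_p p (S_ring p nrm))" using X unfolding GL_def by blast
  ultimately show ?thesis using X S_invert_p_subset unfolding Mat_def
    by (intro exI[of _ W] exI[of _ 1]) auto
next
  assume "\<exists>x y. x \<noteq> 0 \<and> y \<noteq> 0 \<and> X = diag2 x y"
  then obtain x y where "x \<noteq> 0" "y \<noteq> 0" "X = diag2 x y" by blast
  thus ?thesis
    by (intro exI[of _ "diag2 (1 / x) (1 / y)"] exI[of _ "x * y"])
      (auto simp: diag2_invert_p[OF weight_rho] diag2_mult diag2_1 det_diag2)
qed

text \<open>Successive transformations accumulate on the left in \<open>T\<close> and their
  inverses, in the opposite order, in \<open>U\<close>, because the Frobenius is
  multiplicative.\<close>

lemma phi_conj_seq_transformation:
  fixes A :: "nat \<Rightarrow> 'a fps ^ 2 ^ 2"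
  assumes f: "f \<ge> 1"
    and X: "\<forall>n\<ge>1. \<forall>i<f. (X n i \<in> GL (invert_p p (S_ring p nrm)) \<and> det (X n i) = 1) \<or>
          (\<exists>x y. x \<noteq> 0 \<and> y \<noteq> 0 \<and> X n i = diag2 x y)"
  shows "\<exists>T U d. \<forall>i<f. T i \<in> Mat (invert_p p (growth (\<lambda>n. rho ^ n))) \<and>
    U i \<in> Mat (invert_p p (growth (\<lambda>n. rho ^ n))) \<and>
    T i ** U i = mat 1 \<and> U i ** T i = mat 1 \<and> d i \<noteq> 0 \<and> det (T i) = fps_const (d i) \<and>
    phi_conj_seq p f X A n i = T i ** A i ** phi_mat p (U ((i + f - 1) mod f))"
    (is "\<exists>T U d. \<forall>i<f. ?G n T U d i")
proof (induction n)
  case 0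
  have "(mat 1 :: 'a fps ^ 2 ^ 2) \<in> Mat (invert_p p (growth (\<lambda>n. rho ^ n)))"
    using Mat_growth_1[OF weight_rho] subset_invert_p unfolding Mat_def by blast
  thus ?case by (intro exI[of _ "\<lambda>_. mat 1"] exI[of _ "\<lambda>_. 1"]) simp
next
  case (Suc n)
  then obtain T U d where TU: "\<And>i. i < f \<Longrightarrow> ?G n T U d i" by blast
  have "\<exists>W e. X (Suc n) i \<in> Mat (invert_p p (growth (\<lambda>n. rho ^ n))) \<and>
      W \<in> Mat (invert_p p (growth (\<lambda>n. rho ^ n))) \<and>
      X (Suc n) i ** W = mat 1 \<and> W ** X (Suc n) i = mat 1 \<and> e \<noteq> 0 \<and> det (X (Suc n) i) = fps_const e"
    if "i < f" for i
    using transformation_inverse X that by simp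
  then obtain W e where W: "\<And>i. i < f \<Longrightarrow> X (Suc n) i \<in> Mat (invert_p p (growth (\<lambda>n. rho ^ n))) \<and>
      W i \<in> Mat (invert_p p (growth (\<lambda>n. rho ^ n))) \<and> X (Suc n) i ** W i = mat 1 \<and>
      W i ** X (Suc n) i = mat 1 \<and> e i \<noteq> 0 \<and> det (X (Suc n) i) = fps_const (e i)"
    by metis
  show ?case
  proof (rule exI[of _ "\<lambda>i. X (Suc n) i ** T i"], rule exI[of _ "\<lambda>i. U i ** W i"],
      rule exI[of _ "\<lambda>i. e i * d i"], intro allI impI conjI)
    fix i assume i: "i < f"
    note TUi = TU[OF i] and Wi = W[OF i]
    have j: "(i + f - 1) mod f < f" using f by simp
    show "X (Suc n) i ** T i \<in> Mat (invert_p p (growth (\<lambda>n. rho ^ n)))"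
      "U i ** W i \<in> Mat (invert_p p (growth (\<lambda>n. rho ^ n)))"
      using TUi Wi by (auto intro: Mat_invert_p_mult[OF weight_rho])
    have "(X (Suc n) i ** T i) ** (U i ** W i) = X (Suc n) i ** (T i ** U i) ** W i"
      by (simp only: matrix_mul_assoc)
    thus "(X (Suc n) i ** T i) ** (U i ** W i) = mat 1" using TUi Wi by simp
    have "(U i ** W i) ** (X (Suc n) i ** T i) = U i ** (W i ** X (Suc n) i) ** T i"
      by (simp only: matrix_mul_assoc)
    thus "(U i ** W i) ** (X (Suc n) i ** T i) = mat 1" using TUi Wi by simp
    show "e i * d i \<noteq> 0" using TUi Wi by simp
    show "det (X (Suc n) i ** T i) = fps_const (e i * d i)" using TUi Wi by (simp add: det_mul)
    have "matrix_inv (phi_mat p (X (Suc n) ((i + f - 1) mod f))) = phi_mat p (W ((i + f - 1) mod f))"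
      using W[OF j] by (intro matrix_inv_eqI) (simp_all add: phi_mat_mult[symmetric] p_pos)
    thus "phi_conj_seq p f X A (Suc n) i
        = X (Suc n) i ** T i ** A i ** phi_mat p (U ((i + f - 1) mod f) ** W ((i + f - 1) mod f))"
      using TUi by (simp add: phi_conj_def phi_mat_mult p_pos matrix_mul_assoc)
  qed
qed

text \<open>The constant \<open>a\<close> is the coefficient in degree \<open>k\<close>, and
  \<open>k < c * p\<close> lies in the range where a weight equal to 1 bounds both summands and
  hence the determinant.\<close>

lemma integral_plus_I_det_leading_coeff:
  fixes A0 C :: "'a fps ^ 2 ^ 2"
  assumes c: "c \<ge> 1" and k: "k \<le> c * (p - 2)"
    and A0: "A0 \<in> Mat (growth (\<lambda>_. 1))" and C: "C \<in> Mat (growth (wI c))"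
    and det: "det (A0 + C) = E_ser p ^ k * fps_const a"
  shows "nrm a \<le> 1"
proof -
  \<comment> \<open>Subtraction is truncated, so \<open>v\<close> equals 1 in all degrees below
    \<open>c * p\<close>. It is still a weight, and it dominates both 1 and
    \<open>wI c\<close>.\<close>
  define v where "v n = real p ^ (n div p - (c - 1))" for n
  have "(a div p - (c - 1)) + (b div p - (c - 1)) \<le> (a + b) div p - (c - 1)" for a b
    using div_add_div_le[of a b] by linarith
  hence v: "weight v"
    unfolding weight_def v_def power_add[symmetric]
    using p_ge_2 by (intro conjI allI power_increasing one_le_power) auto
  have "wI c n \<le> v n" for n
  proof -
    have "wS n \<le> real p ^ ((c - 1) + (n div p - (c - 1)))"
      unfolding wS_def using p_ge_2 by (intro power_increasing) auto
    hence "(1 / real p) ^ (c - 1) * wS n \<le> (1 / real p) ^ (c - 1) * (real p ^ (c - 1) * v n)"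
      by (intro mult_left_mono) (auto simp: v_def power_add)
    also have "\<dots> = v n" using p_pos by (simp add: power_one_over)
    finally have "nrm \<pi> * ((1 / real p) ^ (c - 1) * wS n) \<le> 1 * v n"
      using nrm_pi_less_1 nrm_nonneg weight_nonneg[OF weight_wS] by (intro mult_mono) auto
    thus ?thesis by (simp add: wI_def)
  qed
  hence "C \<in> Mat (growth v)" using Mat_growth_mono[OF C] by blast
  moreover have "A0 \<in> Mat (growth v)" using Mat_growth_mono[OF A0 weight_ge_1[OF v]] .
  ultimately have "det (A0 + C) \<in> growth v" using det_growth[OF v] Mat_growth_add by blast
  hence "nrm (fps_nth (det (A0 + C)) k) \<le> v k" by (rule growthD)
  moreover have "fps_nth (det (A0 + C)) k = a" unfolding det using E_ser_power_nth[of k] by simp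
  moreover have "k div p \<le> c - 1"
  proof -
    have "c * (p - 2) < c * p" using c p_ge_2 by simp
    hence "k < c * p" using k by linarith
    hence "k div p < c" by (simp add: less_mult_imp_div_less)
    thus ?thesis by simp
  qed
  ultimately show ?thesis by (simp add: v_def)
qed

end

section \<open>Units around the cycle and the final change of basis\<close>

theorem theorem6p4:
  fixes p f c m :: nat
    and nrm :: "'a::field_char_0 \<Rightarrow> real"
    and \<pi> :: 'a
    and k :: "nat \<Rightarrow> nat"
    and A A0 C :: "nat \<Rightarrow> 'a fps ^ 2 ^ 2"
    and X :: "nat \<Rightarrow> nat \<Rightarrow> 'a fps ^ 2 ^ 2"
  assumes F: "finite_ext_Qp p nrm"
    and unif: "uniformizer nrm \<pi>"
    and S_sub_R: "S_ring p nrm \<subseteq> R_ring p nrm \<pi>"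
    and p: "p > 2"
    and f: "f \<ge> 1"
    and A_height: "\<forall>i<f. A i \<in> Mat_height p (k i) (S_ring p nrm)"
    and A_det: "\<forall>i<f. \<exists>a \<in> integer_units nrm. det (A i) = E_ser p ^ k i * fps_const a"
    and c: "c > 1"
    and c_bound: "\<forall>i<f. k i \<le> c * (p - 2)"
    and X: "\<forall>n\<ge>1. \<forall>i<f.
          (X n i \<in> GL (invert_p p (S_ring p nrm)) \<and> det (X n i) = 1) \<or>
          (\<exists>x y. x \<noteq> 0 \<and> y \<noteq> 0 \<and> X n i = diag2 x y)"
    and m: "m > 0"
    and A0: "\<forall>i<f. A0 i \<in> Mat (frakS nrm)"
    and C: "\<forall>i<f. C i \<in> Mat (I_ideal p nrm \<pi> c)"
    and A_m: "\<forall>i<f. phi_conj_seq p f X A m i = A0 i + C i"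
  shows "\<exists>Y :: nat \<Rightarrow> 'a fps ^ 2 ^ 2.
      (\<forall>i<f. Y i \<in> GL (invert_p p (R_ring p nrm \<pi>))) \<and>
      (\<forall>i<f. phi_conj p f Y A i \<in> Mat_height p (k i) (frakS nrm) \<and>
         phi_conj p f Y A i - A0 i \<in> Mat ((\<lambda>g. fps_const \<pi> * g) ` frakS nrm))"
proof -
  interpret finite_ext_Qp p nrm by fact
  interpret ramified_ext p nrm \<pi> by unfold_locales fact+
  let ?K = "invert_p p (growth (\<lambda>n. rho ^ n))" and ?prev = "\<lambda>i. (i + f - 1) mod f"
  have prev: "?prev i < f" for i using f by simp
  have c1: "c \<ge> 1" using c by simp
  have A0': "\<forall>i<f. A0 i \<in> Mat (growth (\<lambda>_. 1))" using A0 by (simp add: frakS_eq_growth)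
  have C': "\<forall>i<f. C i \<in> Mat (growth (wI c))"
    using C I_ideal_subset_growth[OF c1] unfolding Mat_def by blast
  obtain T U d where TU: "\<And>i. i < f \<Longrightarrow> T i \<in> Mat ?K \<and> U i \<in> Mat ?K \<and> T i ** U i = mat 1 \<and>
      U i ** T i = mat 1 \<and> d i \<noteq> 0 \<and> det (T i) = fps_const (d i) \<and>
      phi_conj_seq p f X A m i = T i ** A i ** phi_mat p (U (?prev i))"
    using phi_conj_seq_transformation[OF f X, of A m] by blast
  have detU: "det (U i) = fps_const (1 / d i)" if "i < f" for i
  proof -
    have "det (T i) * det (U i) = 1" using TU[OF that] by (metis det_mul det_I)
    hence "fps_const (1 / d i) * (fps_const (d i) * det (U i)) = fps_const (1 / d i)"
      using TU[OF that] by simp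
    thus ?thesis using TU[OF that] by (simp add: mult.assoc[symmetric])
  qed
  obtain a where a: "\<And>i. i < f \<Longrightarrow> a i \<in> integer_units nrm \<and> det (A i) = E_ser p ^ k i * fps_const (a i)"
    using A_det by metis
  have nrm_a: "nrm (a i) = 1" if i: "i < f" for i
  proof -
    obtain y where "nrm (a i) \<le> 1" "nrm y \<le> 1" "a i * y = 1"
      using a[OF i] unfolding integer_units_def ring_of_integers_def by blast
    hence "nrm (a i) * nrm y = 1" by (metis nrm_mult nrm_1)
    moreover have "nrm (a i) * nrm y \<le> nrm (a i)"
      using \<open>nrm y \<le> 1\<close> nrm_nonneg by (rule mult_left_le)
    ultimately show ?thesis using \<open>nrm (a i) \<le> 1\<close> by linarith
  qed
  \<comment> \<open>The Frobenius fixes constants, so the composite transformation multiplies the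
    constant of the determinant by \<open>d i\<close> and divides it by the \<open>d\<close> of the
    previous index.\<close>
  define b where "b i = a i * d i / d (?prev i)" for i
  have det_m: "det (A0 i + C i) = E_ser p ^ k i * fps_const (b i)" if i: "i < f" for i
  proof -
    have "det (A0 i + C i) = det (T i) * det (A i) * phi p (det (U (?prev i)))"
      using TU[OF i] A_m i by (metis det_mul phi_det_2 p_pos)
    also have "\<dots> = fps_const (d i) * (E_ser p ^ k i * fps_const (a i)) * fps_const (1 / d (?prev i))"
      using TU[OF i] a[OF i] detU[OF prev] by simp
    also have "\<dots> = E_ser p ^ k i * (fps_const (d i) * fps_const (a i) * fps_const (1 / d (?prev i)))"
      by (simp only: ac_simps)
    finally show ?thesis by (simp add: b_def mult.commute)
  qed
  have b_le: "nrm (b i) \<le> 1" if "i < f" for i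
    using integral_plus_I_det_leading_coeff[OF c1 _ _ _ det_m[OF that]] c_bound A0' C' that by blast
  \<comment> \<open>The factors from \<open>d\<close> cancel around the cycle. As each norm is at
    most 1 and the product is 1, none can be smaller.\<close>
  have "(\<Prod>i<f. nrm (b i)) = (\<Prod>i<f. nrm (d i) / nrm (d (?prev i)))"
    using nrm_a by (intro prod.cong) (auto simp: b_def nrm_divide nrm_mult)
  also have "\<dots> = (\<Prod>i<f. nrm (d i)) / (\<Prod>i<f. nrm (d (?prev i)))" by (rule prod_dividef)
  also have "(\<Prod>i<f. nrm (d (?prev i))) = (\<Prod>i<f. nrm (d i))" using f by (rule prod_cyclic_shift)
  also have "(\<Prod>i<f. nrm (d i)) / (\<Prod>i<f. nrm (d i)) = 1"
    using TU by (simp add: prod_zero_iff nrm_eq_0_iff)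
  finally have b_unit: "nrm (b i) = 1" if "i < f" for i
    using that b_le nrm_nonneg by (intro prod_eq_1_imp_eq_1[of "{..<f}" "\<lambda>i. nrm (b i)"]) auto
  \<comment> \<open>At the start the integral part is \<open>A0 i\<close> itself and the cofactor is
    the constant \<open>b i\<close>.\<close>
  have near: "near_integral c (k i) (A0 i) (A0 i + C i)" if i: "i < f" for i
    unfolding near_integral_def
  proof (intro conjI exI bexI)
    show "A0 i + C i - A0 i \<in> Mat (growth (wI c))" using C' i by simp
    show "A0 i - A0 i \<in> Mat (growth (\<lambda>_. nrm \<pi>))" by (simp add: Mat_def growth_zero nrm_nonneg)
    show "fps_const (b i) \<in> growth wS"
      using b_unit[OF i] weight_nonneg[OF weight_wS] by (intro growth_const) auto
  qed (use b_unit[OF i] det_m[OF i] in auto)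
  then obtain Y V where YV: "\<And>i. i < f \<Longrightarrow> Y i \<in> Mat (growth (\<lambda>n. rho ^ n)) \<and>
      V i \<in> Mat (growth (\<lambda>n. rho ^ n)) \<and> Y i ** V i = mat 1 \<and> V i ** Y i = mat 1 \<and>
      Y i ** (A0 i + C i) ** phi_mat p (V (?prev i)) \<in> Mat_height p (k i) (growth (\<lambda>_. 1)) \<and>
      Y i ** (A0 i + C i) ** phi_mat p (V (?prev i)) - A0 i \<in> Mat (growth (\<lambda>_. nrm \<pi>))"
    using integral_form_exists[OF f c1 c_bound A0', of "\<lambda>i. A0 i + C i"] by blast
  have inv1: "(Y i ** T i) ** (U i ** V i) = mat 1" and inv2: "(U i ** V i) ** (Y i ** T i) = mat 1"
    if "i < f" for i
  proof -
    have "(Y i ** T i) ** (U i ** V i) = Y i ** (T i ** U i) ** V i"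
      "(U i ** V i) ** (Y i ** T i) = U i ** (V i ** Y i) ** T i" by (simp_all only: matrix_mul_assoc)
    thus "(Y i ** T i) ** (U i ** V i) = mat 1" "(U i ** V i) ** (Y i ** T i) = mat 1"
      using TU[OF that] YV[OF that] by simp_all
  qed
  \<comment> \<open>The given transformations act first and the correction second: the composite is
    \<open>Y i ** T i\<close> with inverse \<open>U i ** V i\<close>.\<close>
  have conj_eq: "phi_conj p f (\<lambda>i. Y i ** T i) A i = Y i ** (A0 i + C i) ** phi_mat p (V (?prev i))"
    if i: "i < f" for i
  proof -
    have "matrix_inv (phi_mat p (Y (?prev i) ** T (?prev i))) = phi_mat p (U (?prev i) ** V (?prev i))"
      using inv1[OF prev] inv2[OF prev]
      by (intro matrix_inv_eqI) (simp_all add: phi_mat_mult[symmetric] p_pos)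
    moreover have "A0 i + C i = T i ** A i ** phi_mat p (U (?prev i))" using TU[OF i] A_m i by simp
    ultimately show ?thesis by (simp add: phi_conj_def phi_mat_mult p_pos matrix_mul_assoc)
  qed
  have mem_K: "M \<in> Mat ?K" if "M \<in> Mat (growth (\<lambda>n. rho ^ n))" for M :: "'a fps ^ 2 ^ 2"
    using that subset_invert_p unfolding Mat_def by blast
  have pi_multiple: "growth (\<lambda>_. nrm \<pi>) \<subseteq> (\<lambda>g. fps_const \<pi> * g) ` frakS nrm"
  proof
    fix x assume x: "x \<in> growth (\<lambda>_. nrm \<pi>)"
    have "fps_const (1 / \<pi>) * x \<in> frakS nrm"
      unfolding frakS_eq_growth
    proof (rule growthI)
      fix n
      have "nrm (fps_nth x n) / nrm \<pi> \<le> 1"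
        using growthD[OF x, of n] nrm_pos[OF pi_nonzero] by simp
      thus "nrm (fps_nth (fps_const (1 / \<pi>) * x) n) \<le> 1" by (simp add: nrm_divide)
    qed
    moreover have "x = fps_const \<pi> * (fps_const (1 / \<pi>) * x)"
      using pi_nonzero by (simp add: mult.assoc[symmetric])
    ultimately show "x \<in> (\<lambda>g. fps_const \<pi> * g) ` frakS nrm" by (rule rev_image_eqI)
  qed
  show ?thesis
  proof (intro exI[of _ "\<lambda>i. Y i ** T i"] conjI allI impI)
    fix i assume i: "i < f"
    have "Y i ** T i \<in> Mat ?K" "U i ** V i \<in> Mat ?K"
      using TU[OF i] YV[OF i] mem_K by (auto intro!: Mat_invert_p_mult[OF weight_rho])
    thus "Y i ** T i \<in> GL (invert_p p (R_ring p nrm \<pi>))"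
      unfolding GL_def R_ring_eq_growth using inv1[OF i] inv2[OF i] by blast
    show "phi_conj p f (\<lambda>i. Y i ** T i) A i \<in> Mat_height p (k i) (frakS nrm)"
      unfolding conj_eq[OF i] frakS_eq_growth using YV[OF i] by blast
    show "phi_conj p f (\<lambda>i. Y i ** T i) A i - A0 i \<in> Mat ((\<lambda>g. fps_const \<pi> * g) ` frakS nrm)"
      unfolding conj_eq[OF i] using YV[OF i] pi_multiple unfolding Mat_def by blast
  qed
qed

end
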